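(* Let $C = (\cdots \to C_i \xrightarrow{\partial} C_{i-1} \to \cdots)$ be a chain complex over $\mathbb{F}_2$ and $n$ a non-negative integer such that each degree is a direct sum $C_i = C^n_i \oplus C^{n-1}_i \oplus \cdots \oplus C^0_i$ of $\mathbb{F}_2$-vector spaces, and such that the differential $\partial$ is lower-triangular with respect to this decomposition (i.e. the component $C^s_i \to C^r_{i-1}$ of $\partial$ is zero whenever $r > s$). Denote the diagonal components by $\partial^s : C^s_i \to C^s_{i-1}$ ($0\le s\le n$) and the sub-diagonal components by $g_s : C^s_i \to C^{s-1}_{i-1}$ ($1 \le s \le n$). Then the following are chain complexes over $\mathbb{F}_2$: $$C^s = (\cdots \to C^s_i \xrightarrow{\partial^s} C^s_{i-1} \to \cdots), \quad s = 0,\dots,n,$$ $$C^{\mathbf g} = \big( H_n(\partial^n) \xrightarrow{[g_n]} H_{n-1}(\partial^{n-1}) \to \cdots \xrightarrow{[g_1]} H_0(\partial^0)\big),$$ where $H_i(\partial^s)$ is the $i$-th homology of $C^s$ and $[g_s]$ is the map induced by $g_s$ on homology classes. Moreover, fix $0 \le m \le n$ and suppose that $H_i(\partial^s) = 0$ for all $(s,i)$ with $0 \le s < i \le m$ and for all $(s,i)$ with $m \le i < s \le n$. Then $H_m(\partial^{\mathbf g})$ (the homology of $C^{\mathbf g}$ at $H_m(\partial^m)$) is isomorphic to $H_m(\partial)$ (the $m$-th homology of $C$) via the map $$\llbracket \ell^m_m \rrbracket \mapsto [\ell^m_m \oplus \ell^{m-1}_m \oplus \cdots \oplus \ell^0_m],$$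 where $\ell^m_m \in C^m_m$ is a representative of a class $[\ell^m_m] \in H_m(\partial^m)$, which in turn is a representative of $\llbracket \ell^m_m\rrbracket \in H_m(\partial^{\mathbf g})$, and $\ell^s_m \in C^s_m$ ($0 \le s < m$) are chosen so that $\ell^m_m \oplus \cdots \oplus \ell^0_m \in \ker \partial$ (the existence of such a choice is guaranteed).
   Context: A chain complex over $\mathbb{F}_2$ is a family of $\mathbb{F}_2$-vector spaces $C_i$ with linear maps $\partial : C_i \to C_{i-1}$ such that $\partial\partial=0$. Complexes are assumed to be of finite length and to end in degree $0$ ($C_i=0$ for $i<0$ and for all sufficiently large $i$). The $i$-th homology is $\ker\partial_i/\operatorname{im}\partial_{i+1}$, written $H_i(\partial)$. The complex $C^{\mathbf g}$ has $H_s(\partial^s)$ in degree $s$ for $0\le s\le n$, and zero in all other degrees. $[\ell]$ denotes a homology class in $C$ or in a $C^s$, and $\llbracket \ell\rrbracket$ the class in $H_m(\partial^{\mathbf g})$ of $[\ell]\in H_m(\partial^m)$. The element $\ell^m_m \oplus \cdots \oplus \ell^0_m$ is regarded as an element of $C_m$ with zero components in $C^s_m$ for $s > m$. *)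

theory Defs
  imports "Jordan_Normal_Form.Missing_VectorSpace" "HOL-Number_Theory.Residues"
begin

abbreviation F2 :: "int ring"
  where "F2 \<equiv> residue_ring 2"

text \<open>
  In the module records below, the ring fields \<open>mult\<close> and \<open>one\<close> carry no information:
  \<open>vectorspace\<close> and \<open>linear_map\<close> do not refer to them.
\<close>

definition zero_space :: "'a \<Rightarrow> ('k, 'a) module"
  where "zero_space z =
    \<lparr>carrier = {z}, monoid.mult = (\<lambda>_ _. z), one = z, zero = z, add = (\<lambda>_ _. z), smult = (\<lambda>_ _. z)\<rparr>"

definition quotient_space :: "('k, 'a) module \<Rightarrow> 'a set \<Rightarrow> ('k, 'a set) module"
  where "quotient_space V W =
    \<lparr>carrier = A_RCOSETS V W, monoid.mult = (\<lambda>_ _. W), one = W, zero = W, add = set_add V,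
     smult = (\<lambda>c X. \<Union>x\<in>X. W +>\<^bsub>V\<^esub> (c \<odot>\<^bsub>V\<^esub> x))\<rparr>"

text \<open>
  External direct sum of the family \<open>V\<close> over a finite index set \<open>I\<close>: its elements are the
  families \<open>y\<close> with \<open>y s \<in> carrier (V s)\<close> for \<open>s \<in> I\<close>, extended by \<open>undefined\<close> outside \<open>I\<close>.
\<close>

definition dsum :: "'i set \<Rightarrow> ('i \<Rightarrow> ('k, 'a) module) \<Rightarrow> ('k, 'i \<Rightarrow> 'a) module"
  where "dsum I V =
    \<lparr>carrier = (\<Pi>\<^sub>E s\<in>I. carrier (V s)),
     monoid.mult = (\<lambda>_ _. \<lambda>s\<in>I. \<zero>\<^bsub>V s\<^esub>), one = (\<lambda>s\<in>I. \<zero>\<^bsub>V s\<^esub>), zero = (\<lambda>s\<in>I. \<zero>\<^bsub>V s\<^esub>),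
     add = (\<lambda>x y. \<lambda>s\<in>I. x s \<oplus>\<^bsub>V s\<^esub> y s),
     smult = (\<lambda>c x. \<lambda>s\<in>I. c \<odot>\<^bsub>V s\<^esub> x s)\<rparr>"

definition dsum_incl :: "'i set \<Rightarrow> ('i \<Rightarrow> ('k, 'a) module) \<Rightarrow> 'i \<Rightarrow> 'a \<Rightarrow> ('i \<Rightarrow> 'a)"
  where "dsum_incl I V s x = (\<lambda>r\<in>I. if r = s then x else \<zero>\<^bsub>V r\<^esub>)"

text \<open>
  Degrees are integers, and \<open>d i\<close> is the differential leaving degree \<open>i\<close>. Complexes have
  finite length and end in degree 0.
\<close>

locale chain_complex =
  fixes K :: "('k, 'm) ring_scheme"
    and C :: "int \<Rightarrow> ('k, 'a) module"
    and d :: "int \<Rightarrow> 'a \<Rightarrow> 'a"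
  assumes linear: "linear_map K (C i) (C (i - 1)) (d i)"
    and d_d: "x \<in> carrier (C i) \<Longrightarrow> d (i - 1) (d i x) = \<zero>\<^bsub>C (i - 2)\<^esub>"
    and zero_below: "i < 0 \<Longrightarrow> carrier (C i) = {\<zero>\<^bsub>C i\<^esub>}"
    and zero_above: "\<exists>N. \<forall>i>N. carrier (C i) = {\<zero>\<^bsub>C i\<^esub>}"

definition cycles :: "(int \<Rightarrow> ('k, 'a) module) \<Rightarrow> (int \<Rightarrow> 'a \<Rightarrow> 'a) \<Rightarrow> int \<Rightarrow> 'a set"
  where "cycles C d i = {x \<in> carrier (C i). d i x = \<zero>\<^bsub>C (i - 1)\<^esub>}"

definition boundaries :: "(int \<Rightarrow> ('k, 'a) module) \<Rightarrow> (int \<Rightarrow> 'a \<Rightarrow> 'a) \<Rightarrow> int \<Rightarrow> 'a set"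
  where "boundaries C d i = d (i + 1) ` carrier (C (i + 1))"

definition homology ::
    "(int \<Rightarrow> ('k, 'a) module) \<Rightarrow> (int \<Rightarrow> 'a \<Rightarrow> 'a) \<Rightarrow> int \<Rightarrow> ('k, 'a set) module"
  where "homology C d i =
    quotient_space ((C i)\<lparr>carrier := cycles C d i\<rparr>) (boundaries C d i)"

definition hclass ::
    "(int \<Rightarrow> ('k, 'a) module) \<Rightarrow> (int \<Rightarrow> 'a \<Rightarrow> 'a) \<Rightarrow> int \<Rightarrow> 'a \<Rightarrow> 'a set"
  where "hclass C d i x = boundaries C d i +>\<^bsub>C i\<^esub> x"

text \<open>
  The map on homology induced by \<open>f\<close>, with values in degree \<open>j\<close> of the complex \<open>(C, d)\<close>: it
  sends a class \<open>X\<close> to the union of the classes of \<open>f x\<close> for all representatives \<open>x\<close> of \<open>X\<close>.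
  If \<open>f\<close> respects classes, all these coincide.
\<close>

definition induced ::
    "(int \<Rightarrow> ('k, 'a) module) \<Rightarrow> (int \<Rightarrow> 'a \<Rightarrow> 'a) \<Rightarrow> int \<Rightarrow> ('b \<Rightarrow> 'a) \<Rightarrow> 'b set \<Rightarrow> 'a set"
  where "induced C d j f X = (\<Union>x\<in>X. hclass C d j (f x))"

text \<open>
  From here on \<open>C s i\<close> is the \<open>s\<close>-th summand in degree \<open>i\<close>; only \<open>0 \<le> s \<le> n\<close> is relevant.
\<close>

definition total_space ::
    "int \<Rightarrow> (int \<Rightarrow> int \<Rightarrow> ('k, 'a) module) \<Rightarrow> int \<Rightarrow> ('k, int \<Rightarrow> 'a) module"
  where "total_space n C i = dsum {0..n} (\<lambda>s. C s i)"

text \<open>\<open>component n C d r s i\<close> is the component of \<open>d i\<close> from \<open>C s i\<close> to \<open>C r (i - 1)\<close>.\<close>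

definition component ::
    "int \<Rightarrow> (int \<Rightarrow> int \<Rightarrow> ('k, 'a) module) \<Rightarrow> (int \<Rightarrow> (int \<Rightarrow> 'a) \<Rightarrow> (int \<Rightarrow> 'a))
      \<Rightarrow> int \<Rightarrow> int \<Rightarrow> int \<Rightarrow> 'a \<Rightarrow> 'a"
  where "component n C d r s i x = d i (dsum_incl {0..n} (\<lambda>t. C t i) s x) r"

definition lower_triangular ::
    "int \<Rightarrow> (int \<Rightarrow> int \<Rightarrow> ('k, 'a) module) \<Rightarrow> (int \<Rightarrow> (int \<Rightarrow> 'a) \<Rightarrow> (int \<Rightarrow> 'a)) \<Rightarrow> bool"
  where "lower_triangular n C d \<longleftrightarrow>
    (\<forall>i. \<forall>s\<in>{0..n}. \<forall>r\<in>{0..n}. r > s \<longrightarrow>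
      (\<forall>x\<in>carrier (C s i). component n C d r s i x = \<zero>\<^bsub>C r (i - 1)\<^esub>))"

definition diag ::
    "int \<Rightarrow> (int \<Rightarrow> int \<Rightarrow> ('k, 'a) module) \<Rightarrow> (int \<Rightarrow> (int \<Rightarrow> 'a) \<Rightarrow> (int \<Rightarrow> 'a))
      \<Rightarrow> int \<Rightarrow> int \<Rightarrow> 'a \<Rightarrow> 'a"
  where "diag n C d s = component n C d s s"

definition subdiag ::
    "int \<Rightarrow> (int \<Rightarrow> int \<Rightarrow> ('k, 'a) module) \<Rightarrow> (int \<Rightarrow> (int \<Rightarrow> 'a) \<Rightarrow> (int \<Rightarrow> 'a))
      \<Rightarrow> int \<Rightarrow> int \<Rightarrow> 'a \<Rightarrow> 'a"
  where "subdiag n C d s = component n C d (s - 1) s"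

text \<open>
  The complex with \<open>s\<close>-th homology of \<open>(C s, diag n C d s)\<close> in degree \<open>s\<close> for \<open>0 \<le> s \<le> n\<close>, zero
  in all other degrees (\<open>{}\<close> is only a name for the unique element there).
\<close>

definition g_space ::
    "int \<Rightarrow> (int \<Rightarrow> int \<Rightarrow> ('k, 'a) module) \<Rightarrow> (int \<Rightarrow> (int \<Rightarrow> 'a) \<Rightarrow> (int \<Rightarrow> 'a))
      \<Rightarrow> int \<Rightarrow> ('k, 'a set) module"
  where "g_space n C d s =
    (if s \<in> {0..n} then homology (C s) (diag n C d s) s else zero_space {})"

definition g_diff ::
    "int \<Rightarrow> (int \<Rightarrow> int \<Rightarrow> ('k, 'a) module) \<Rightarrow> (int \<Rightarrow> (int \<Rightarrow> 'a) \<Rightarrow> (int \<Rightarrow> 'a))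
      \<Rightarrow> int \<Rightarrow> 'a set \<Rightarrow> 'a set"
  where "g_diff n C d s =
    (if s \<in> {1..n}
     then induced (C (s - 1)) (diag n C d (s - 1)) (s - 1) (subdiag n C d s s)
     else (\<lambda>_. \<zero>\<^bsub>g_space n C d (s - 1)\<^esub>))"

end

theory Submission
  imports Defs
begin

text \<open>
  The differential preserves the subspaces \<open>F\<^sub>p = C\<^sup>p \<oplus> \<dots> \<oplus> C\<^sup>0\<close>, and it acts on \<open>F\<^sub>p / F\<^sub>p\<^sub>-\<^sub>1\<close> as the
  diagonal component. Where the homology of the diagonal components vanishes, an element whose
  boundary lies in \<open>F\<^sub>q\<close> can therefore be pushed down into \<open>F\<^sub>q\<close>, one component at a time, by
  subtracting boundaries. Let \<open>Z\<close> be the space of cycles of degree \<open>m\<close> in \<open>F\<^sub>m\<close>. Both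
  \<open>y \<mapsto> \<lbrakk>y\<^sub>m\<rbrakk>\<close> and \<open>y \<mapsto> [y]\<close> are linear on \<open>Z\<close>, and the pushing argument shows that both are
  surjective with the same kernel, which yields the isomorphism.
\<close>

section \<open>Vector spaces\<close>

text \<open>Neither vanishing range covers the positions \<open>s = i\<close>, so no pushing can
  cross them; the complex of homology classes records what happens there. A cycle of degree
  \<open>m\<close> can thus be pushed only as far as \<open>F\<^sub>m\<close>, an element of degree
  \<open>m + 1\<close> only as far as \<open>F\<^sub>m\<^sub>+\<^sub>1\<close>, and in degree
  \<open>m - 1\<close> boundaries can be cleared only once they lie in
  \<open>F\<^sub>m\<^sub>-\<^sub>2\<close>. The gaps of one step are bridged by two descriptions,
  valid for a cycle \<open>l\<close> of the diagonal differential: its class is a cycle for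
  \<open>[g]\<close> iff \<open>l\<close> is the top component of some \<open>y\<close> in
  \<open>F\<^sub>m\<close> with boundary in \<open>F\<^sub>m\<^sub>-\<^sub>2\<close>, and a boundary
  iff \<open>l\<close> is the top component of a boundary that lies in \<open>F\<^sub>m\<close> and
  comes from \<open>F\<^sub>m\<^sub>+\<^sub>1\<close>. In terms of the spectral sequence of the
  filtration, this is the second page at one spot, and the vanishing ranges keep later differentials
  away from it. Maps out of \<open>Z\<close> are compared, rather than a map between the homologies
  being defined by choices: independence of the representative and of its lower components is then
  contained in the equality of the kernels.\<close>

lemma subspaceI:
  assumes "vectorspace K V" and "W \<subseteq> carrier V" and "\<zero>\<^bsub>V\<^esub> \<in> W"
    and "\<And>x y. x \<in> W \<Longrightarrow> y \<in> W \<Longrightarrow> x \<oplus>\<^bsub>V\<^esub> y \<in> W"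
    and "\<And>c x. c \<in> carrier K \<Longrightarrow> x \<in> W \<Longrightarrow> c \<odot>\<^bsub>V\<^esub> x \<in> W"
  shows "VectorSpace.subspace K W V"
  using assms by (simp add: VectorSpace.subspace_def LinearCombinations.submodule_def vectorspace_def)

lemma linear_mapI:
  assumes "vectorspace K V" and "vectorspace K W"
    and "\<And>x. x \<in> carrier V \<Longrightarrow> f x \<in> carrier W"
    and "\<And>x y. x \<in> carrier V \<Longrightarrow> y \<in> carrier V \<Longrightarrow> f (x \<oplus>\<^bsub>V\<^esub> y) = f x \<oplus>\<^bsub>W\<^esub> f y"
    and "\<And>c x. c \<in> carrier K \<Longrightarrow> x \<in> carrier V \<Longrightarrow> f (c \<odot>\<^bsub>V\<^esub> x) = c \<odot>\<^bsub>W\<^esub> f x"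
  shows "linear_map K V W f"
  using assms
  by (simp add: linear_map_def mod_hom_def mod_hom_axioms_def LinearCombinations.module_hom_def vectorspace_def)

text \<open>Transport of structure along a surjection: every axiom for \<open>Q\<close> is the image
  of the same axiom for \<open>V\<close>. For a quotient space this reduces all verifications to the
  compatibility of forming cosets with the operations.\<close>

lemma vectorspace_surj_image:
  assumes V: "vectorspace K V" and carrier: "carrier Q = f ` carrier V"
    and zero: "\<zero>\<^bsub>Q\<^esub> = f \<zero>\<^bsub>V\<^esub>"
    and add: "\<And>x y. x \<in> carrier V \<Longrightarrow> y \<in> carrier V \<Longrightarrow> f (x \<oplus>\<^bsub>V\<^esub> y) = f x \<oplus>\<^bsub>Q\<^esub> f y"
    and smult: "\<And>c x. c \<in> carrier K \<Longrightarrow> x \<in> carrier V \<Longrightarrow> f (c \<odot>\<^bsub>V\<^esub> x) = c \<odot>\<^bsub>Q\<^esub> f x"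
  shows "vectorspace K Q" and "linear_map K V Q f"
proof -
  interpret V: vectorspace K V by fact
  note s = add[symmetric] smult[symmetric]
  show "vectorspace K Q"
  proof (rule vs_criteria)
    show "\<forall>v\<in>carrier Q. \<exists>neg_v\<in>carrier Q. v \<oplus>\<^bsub>Q\<^esub> neg_v = \<zero>\<^bsub>Q\<^esub>"
    proof
      fix v assume "v \<in> carrier Q"
      then obtain x where x: "x \<in> carrier V" "v = f x" using carrier by auto
      then show "\<exists>neg_v\<in>carrier Q. v \<oplus>\<^bsub>Q\<^esub> neg_v = \<zero>\<^bsub>Q\<^esub>"
        by (intro bexI[of _ "f (\<ominus>\<^bsub>V\<^esub> x)"]) (simp_all add: s carrier zero V.M.r_neg)
    qed
    show "field K" by (rule V.field.field_axioms)
  qed (auto simp: carrier s zero V.M.a_assoc V.smult_assoc1 V.smult_l_distr V.smult_r_distr V.M.add.m_ac)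
  with V show "linear_map K V Q f"
    by (intro linear_mapI) (auto simp: carrier add smult)
qed

text \<open>Closure under negation comes from scaling by \<open>-1\<close>. The lemma makes the
  theory of additive cosets available for subspaces.\<close>

lemma subspace_abelian_subgroup:
  assumes "VectorSpace.subspace K W V"
  shows "abelian_subgroup W V"
proof -
  interpret W: VectorSpace.subspace K W V by fact
  interpret V: vectorspace K V by (rule W.vs)
  interpret S: LinearCombinations.submodule K W V by (rule W.submod)
  have "\<ominus>\<^bsub>V\<^esub> x \<in> W" if "x \<in> W" for x
  proof -
    have "x \<in> carrier V" using that S.subset by blast
    moreover have "(\<ominus>\<^bsub>K\<^esub> \<one>\<^bsub>K\<^esub>) \<odot>\<^bsub>V\<^esub> x \<in> W" using that by (intro S.smult_closed) simp_all
    ultimately show ?thesis by (simp add: V.smult_l_minus)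
  qed
  then have "additive_subgroup W V"
    using S.subset
    by (intro additive_subgroupI subgroup.intro) (auto simp flip: a_inv_def)
  then show ?thesis
    by (rule abelian_subgroupI3) (rule V.M.abelian_group_axioms)
qed

lemma coset_eq_iff:
  assumes "VectorSpace.subspace K W V" and "x \<in> carrier V" and "y \<in> carrier V"
  shows "W +>\<^bsub>V\<^esub> x = W +>\<^bsub>V\<^esub> y \<longleftrightarrow> x \<ominus>\<^bsub>V\<^esub> y \<in> W"
proof -
  interpret abelian_subgroup W V by (rule subspace_abelian_subgroup) fact
  show ?thesis
    using assms(2,3) a_repr_independence' a_repr_independenceD a_rcos_module
    unfolding a_minus_def by metis
qed

text \<open>Cosets are formed by the operations of the ambient space \<open>V\<close>, not of its subspace \<open>Z\<close>.\<close>

lemma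
  assumes Z: "VectorSpace.subspace K Z V" and W: "VectorSpace.subspace K W V" and "W \<subseteq> Z"
  shows quotient_space_vectorspace: "vectorspace K (quotient_space (V\<lparr>carrier := Z\<rparr>) W)"
    and coset_linear_map:
      "linear_map K (V\<lparr>carrier := Z\<rparr>) (quotient_space (V\<lparr>carrier := Z\<rparr>) W) (\<lambda>x. W +>\<^bsub>V\<^esub> x)"
proof -
  interpret V: vectorspace K V using Z by (simp add: VectorSpace.subspace_def)
  interpret W: abelian_subgroup W V by (rule subspace_abelian_subgroup) fact
  have V': "vectorspace K (V\<lparr>carrier := Z\<rparr>)" by (rule V.subspace_is_vs) fact
  have Z_sub: "x \<in> carrier V" if "x \<in> Z" for x
    using Z that by (auto simp: VectorSpace.subspace_def LinearCombinations.submodule_def)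
  have W_smult: "c \<odot>\<^bsub>V\<^esub> x \<in> W" if "c \<in> carrier K" "x \<in> W" for c x
    using W that by (auto simp: VectorSpace.subspace_def LinearCombinations.submodule_def)
  \<comment> \<open>The scalar multiple of a coset is encoded as a union over representatives. Since
    \<open>W\<close> is closed under scaling, all of them contribute the same coset, and
    \<open>x\<close> itself is one of them, so the union collapses.\<close>
  have smult: "(\<Union>y\<in>W +>\<^bsub>V\<^esub> x. W +>\<^bsub>V\<^esub> (c \<odot>\<^bsub>V\<^esub> y)) = W +>\<^bsub>V\<^esub> (c \<odot>\<^bsub>V\<^esub> x)"
    if c: "c \<in> carrier K" and x: "x \<in> Z" for c x
  proof -
    have "W +>\<^bsub>V\<^esub> (c \<odot>\<^bsub>V\<^esub> y) = W +>\<^bsub>V\<^esub> (c \<odot>\<^bsub>V\<^esub> x)" if "y \<in> W +>\<^bsub>V\<^esub> x" for y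
    proof -
      from that obtain w where w: "w \<in> W" "y = w \<oplus>\<^bsub>V\<^esub> x"
        by (auto simp: a_r_coset_def')
      then have "c \<odot>\<^bsub>V\<^esub> y \<in> W +>\<^bsub>V\<^esub> (c \<odot>\<^bsub>V\<^esub> x)"
        using c Z_sub[OF x] W_smult[OF c w(1)] by (auto simp: a_r_coset_def' V.smult_r_distr)
      then show ?thesis
        using c Z_sub[OF x] by (metis W.a_repr_independence' V.smult_closed)
    qed
    moreover have "x \<in> W +>\<^bsub>V\<^esub> x" using Z_sub[OF x] by (rule W.a_rcos_self)
    ultimately show ?thesis by blast
  qed
  let ?Q = "quotient_space (V\<lparr>carrier := Z\<rparr>) W"
  \<comment> \<open>Cosets depend only on the addition, which restricting the carrier leaves
    unchanged.\<close>
  have coset: "a_r_coset (V\<lparr>carrier := Z\<rparr>) W x = W +>\<^bsub>V\<^esub> x" for x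
    by (simp add: a_r_coset_def')
  have 1: "carrier ?Q = (\<lambda>x. W +>\<^bsub>V\<^esub> x) ` carrier (V\<lparr>carrier := Z\<rparr>)"
    by (auto simp: quotient_space_def A_RCOSETS_def' coset)
  have 2: "\<zero>\<^bsub>?Q\<^esub> = W +>\<^bsub>V\<^esub> \<zero>\<^bsub>V\<lparr>carrier := Z\<rparr>\<^esub>"
    by (simp add: quotient_space_def W.a_subset)
  have 3: "W +>\<^bsub>V\<^esub> (x \<oplus>\<^bsub>V\<lparr>carrier := Z\<rparr>\<^esub> y) = (W +>\<^bsub>V\<^esub> x) \<oplus>\<^bsub>?Q\<^esub> (W +>\<^bsub>V\<^esub> y)"
    if "x \<in> carrier (V\<lparr>carrier := Z\<rparr>)" "y \<in> carrier (V\<lparr>carrier := Z\<rparr>)" for x y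
    using W.a_rcos_sum[of x y] that Z_sub
    by (simp add: quotient_space_def set_add_def')
  have 4: "W +>\<^bsub>V\<^esub> (c \<odot>\<^bsub>V\<lparr>carrier := Z\<rparr>\<^esub> x) = c \<odot>\<^bsub>?Q\<^esub> (W +>\<^bsub>V\<^esub> x)"
    if "c \<in> carrier K" "x \<in> carrier (V\<lparr>carrier := Z\<rparr>)" for c x
    using smult[of c x] that by (simp add: quotient_space_def coset)
  show "vectorspace K ?Q"
    and "linear_map K (V\<lparr>carrier := Z\<rparr>) ?Q (\<lambda>x. W +>\<^bsub>V\<^esub> x)"
    using vectorspace_surj_image[OF V' 1 2 3 4] by blast+
qed

context abelian_group
begin

lemma minus_eq_zero_iff:
  assumes "a \<in> carrier G" "b \<in> carrier G"
  shows "a \<ominus> b = \<zero> \<longleftrightarrow> a = b"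
  using assms by (metis a_minus_def a_inv_closed minus_equality r_neg minus_minus)

lemma add_diff_cancel:
  assumes "a \<in> carrier G" "b \<in> carrier G"
  shows "b \<oplus> (a \<ominus> b) = a" and "(b \<oplus> a) \<ominus> b = a"
  using assms by (simp_all add: minus_eq a_ac r_neg r_neg1 r_neg2)

lemma minus_zero_right:
  assumes "a \<in> carrier G"
  shows "a \<ominus> \<zero> = a"
  using assms add_diff_cancel(1)[of a \<zero>] by simp

end

lemma linear_map_compose:
  assumes f: "linear_map K U V f" and g: "linear_map K V W g"
  shows "linear_map K U W (\<lambda>x. g (f x))"
proof (rule linear_mapI)
  show "vectorspace K U" "vectorspace K W"
    using f g by (simp_all add: linear_map_def)
qed (simp_all add: linear_map.T_im[OF f] linear_map.T_add[OF f] linear_map.T_smult[OF f]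
    linear_map.T_im[OF g] linear_map.T_add[OF g] linear_map.T_smult[OF g])

lemma zero_space_vectorspace: "field K \<Longrightarrow> vectorspace K (zero_space z)"
  by (rule vs_criteria) (auto simp: zero_space_def)

lemma linear_map_zero:
  assumes "vectorspace K V" "vectorspace K W"
  shows "linear_map K V W (\<lambda>_. \<zero>\<^bsub>W\<^esub>)"
proof -
  interpret W: vectorspace K W by fact
  show ?thesis using assms by (intro linear_mapI) simp_all
qed

text \<open>Both targets are copies of \<open>V\<close> modulo the common kernel. The last clause
  determines \<open>\<phi>\<close>, and it holds for every \<open>v\<close>, so the value never
  depends on which preimage is chosen.\<close>

lemma linear_iso_of_same_kernel:
  assumes f: "linear_map K V X f" and h: "linear_map K V Y h"
    and surj: "f ` carrier V = carrier X" "h ` carrier V = carrier Y"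
    and kernel: "\<And>v. v \<in> carrier V \<Longrightarrow> f v = \<zero>\<^bsub>X\<^esub> \<longleftrightarrow> h v = \<zero>\<^bsub>Y\<^esub>"
  shows "\<exists>\<phi>. linear_map K X Y \<phi> \<and> bij_betw \<phi> (carrier X) (carrier Y) \<and>
    (\<forall>v\<in>carrier V. \<phi> (f v) = h v)"
proof -
  interpret V: vectorspace K V using f by (simp add: linear_map_def)
  interpret X: vectorspace K X using f by (simp add: linear_map_def)
  interpret Y: vectorspace K Y using h by (simp add: linear_map_def)
  interpret f: linear_map K V X f by fact
  interpret h: linear_map K V Y h by fact
  \<comment> \<open>Equal kernels give equal fibres, by passing to differences. One direction makes
    \<open>\<phi>\<close> well defined, the other makes it injective.\<close>
  have eq: "f v = f w \<longleftrightarrow> h v = h w" if "v \<in> carrier V" "w \<in> carrier V" for v w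
  proof -
    have "f (v \<ominus>\<^bsub>V\<^esub> w) = f v \<ominus>\<^bsub>X\<^esub> f w" "h (v \<ominus>\<^bsub>V\<^esub> w) = h v \<ominus>\<^bsub>Y\<^esub> h w"
      using that f.T_minus h.T_minus by blast+
    moreover have "v \<ominus>\<^bsub>V\<^esub> w \<in> carrier V" "f v \<in> carrier X" "f w \<in> carrier X"
      "h v \<in> carrier Y" "h w \<in> carrier Y"
      using that f.T_im h.T_im abelian_group.minus_closed[OF V.M.abelian_group_axioms] by blast+
    ultimately show ?thesis
      using kernel[of "v \<ominus>\<^bsub>V\<^esub> w"] abelian_group.minus_eq_zero_iff[OF X.M.abelian_group_axioms]
      abelian_group.minus_eq_zero_iff[OF Y.M.abelian_group_axioms] by metis
  qed
  \<comment> \<open>An arbitrary preimage under \<open>f\<close> is taken; by \<open>eq\<close> the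
    choice does not affect the value of \<open>h\<close>.\<close>
  define \<phi> where "\<phi> x = h (inv_into (carrier V) f x)" for x
  have \<phi>: "\<phi> (f v) = h v" if "v \<in> carrier V" for v
    using that eq[of "inv_into (carrier V) f (f v)" v] f_inv_into_f[OF imageI[OF that]]
      inv_into_into[OF imageI[OF that]] unfolding \<phi>_def by blast
  have X: "\<exists>v. v \<in> carrier V \<and> x = f v" if "x \<in> carrier X" for x
    using that unfolding surj(1)[symmetric] by (simp only: image_iff Bex_def)
  have "linear_map K X Y \<phi>"
  proof (rule linear_mapI)
    fix x assume "x \<in> carrier X"
    then obtain v where v: "v \<in> carrier V" "x = f v" using X by metis
    show "\<phi> x \<in> carrier Y"
      unfolding v(2) \<phi>[OF v(1)] by (rule h.T_im[OF v(1)])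
    fix c assume c: "c \<in> carrier K"
    show "\<phi> (c \<odot>\<^bsub>X\<^esub> x) = c \<odot>\<^bsub>Y\<^esub> \<phi> x"
      unfolding v(2) \<phi>[OF v(1)] f.T_smult[OF c v(1), symmetric] h.T_smult[OF c v(1), symmetric]
      by (rule \<phi>[OF V.smult_closed[OF c v(1)]])
  next
    fix x y assume "x \<in> carrier X" "y \<in> carrier X"
    then obtain v w where v: "v \<in> carrier V" "x = f v" and w: "w \<in> carrier V" "y = f w"
      using X by metis
    show "\<phi> (x \<oplus>\<^bsub>X\<^esub> y) = \<phi> x \<oplus>\<^bsub>Y\<^esub> \<phi> y"
      unfolding v(2) w(2) \<phi>[OF v(1)] \<phi>[OF w(1)]
        f.T_add[OF v(1) w(1), symmetric] h.T_add[OF v(1) w(1), symmetric]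
      by (rule \<phi>[OF V.M.add.m_closed[OF v(1) w(1)]])
  qed (rule X.vectorspace_axioms Y.vectorspace_axioms)+
  moreover have "bij_betw \<phi> (carrier X) (carrier Y)"
  proof (rule bij_betw_imageI)
    show "inj_on \<phi> (carrier X)"
    proof (rule inj_onI)
      fix x y assume xy: "x \<in> carrier X" "y \<in> carrier X" "\<phi> x = \<phi> y"
      then obtain v w where v: "v \<in> carrier V" "x = f v" and w: "w \<in> carrier V" "y = f w"
        using X by metis
      show "x = y" using xy(3) eq[OF v(1) w(1)] unfolding v(2) w(2) \<phi>[OF v(1)] \<phi>[OF w(1)] by (rule iffD2[rotated])
    qed
    show "\<phi> ` carrier X = carrier Y"
      unfolding surj[symmetric] image_image using \<phi> by (rule image_cong[OF refl])
  qed
  ultimately show ?thesis using \<phi> by metis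
qed

section \<open>Homology\<close>

context chain_complex
begin

lemma vectorspace: "vectorspace K (C i)"
  using linear[of i] by (simp add: linear_map_def)

lemma d_closed: "x \<in> carrier (C i) \<Longrightarrow> d i x \<in> carrier (C (i - 1))"
  using linear_map.T_im[OF linear] .

lemma cycles_subspace: "VectorSpace.subspace K (cycles C d i) (C i)"
proof -
  interpret linear_map K "C i" "C (i - 1)" "d i" by (rule linear)
  show ?thesis using kerT_is_subspace by (simp add: ker_def cycles_def)
qed

lemma boundaries_subspace: "VectorSpace.subspace K (boundaries C d i) (C i)"
proof -
  interpret linear_map K "C (i + 1)" "C i" "d (i + 1)" using linear[of "i + 1"] by simp
  show ?thesis using imT_is_subspace by (simp add: im_def boundaries_def)
qed

lemma boundaries_subset_cycles: "boundaries C d i \<subseteq> cycles C d i"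
  using d_d[of _ "i + 1"] d_closed[of _ "i + 1"] by (auto simp: boundaries_def cycles_def)

lemma cycles_carrier: "x \<in> cycles C d i \<Longrightarrow> x \<in> carrier (C i)"
  by (simp add: cycles_def)

lemma boundariesI: "x \<in> carrier (C (i + 1)) \<Longrightarrow> d (i + 1) x \<in> boundaries C d i"
  by (simp add: boundaries_def)

lemma homology_vectorspace: "vectorspace K (homology C d i)"
  unfolding homology_def
  by (intro quotient_space_vectorspace cycles_subspace boundaries_subspace boundaries_subset_cycles)

lemma hclass_linear:
  "linear_map K ((C i)\<lparr>carrier := cycles C d i\<rparr>) (homology C d i) (hclass C d i)"
  unfolding homology_def hclass_def[abs_def]
  by (intro coset_linear_map cycles_subspace boundaries_subspace boundaries_subset_cycles)

lemma hclass_add: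
  assumes "x \<in> cycles C d i" "y \<in> cycles C d i"
  shows "hclass C d i (x \<oplus>\<^bsub>C i\<^esub> y) = hclass C d i x \<oplus>\<^bsub>homology C d i\<^esub> hclass C d i y"
  by (rule linear_map.T_add[OF hclass_linear, simplified, OF assms])

lemma hclass_smult:
  assumes "c \<in> carrier K" "x \<in> cycles C d i"
  shows "hclass C d i (c \<odot>\<^bsub>C i\<^esub> x) = c \<odot>\<^bsub>homology C d i\<^esub> hclass C d i x"
  by (rule linear_map.T_smult[OF hclass_linear, simplified, OF assms])

lemma cycles_add: "x \<in> cycles C d i \<Longrightarrow> y \<in> cycles C d i \<Longrightarrow> x \<oplus>\<^bsub>C i\<^esub> y \<in> cycles C d i"
  and cycles_smult: "c \<in> carrier K \<Longrightarrow> x \<in> cycles C d i \<Longrightarrow> c \<odot>\<^bsub>C i\<^esub> x \<in> cycles C d i"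
  using cycles_subspace[of i] by (simp_all add: VectorSpace.subspace_def LinearCombinations.submodule_def)

lemma carrier_homology: "carrier (homology C d i) = hclass C d i ` cycles C d i"
  by (auto simp: homology_def quotient_space_def hclass_def A_RCOSETS_def' a_r_coset_def')

lemma hclass_eq_iff:
  assumes "x \<in> carrier (C i)" "y \<in> carrier (C i)"
  shows "hclass C d i x = hclass C d i y \<longleftrightarrow> x \<ominus>\<^bsub>C i\<^esub> y \<in> boundaries C d i"
  unfolding hclass_def using assms by (intro coset_eq_iff[OF boundaries_subspace])

lemma zero_homology: "\<zero>\<^bsub>homology C d i\<^esub> = boundaries C d i"
  by (simp add: homology_def quotient_space_def)

lemma hclass_eq_zero_iff:
  assumes "x \<in> carrier (C i)"
  shows "hclass C d i x = \<zero>\<^bsub>homology C d i\<^esub> \<longleftrightarrow> x \<in> boundaries C d i"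
proof -
  interpret abelian_subgroup "boundaries C d i" "C i"
    by (rule subspace_abelian_subgroup) (rule boundaries_subspace)
  have r_neg_zero: "\<ominus>\<^bsub>C i\<^esub> \<zero>\<^bsub>C i\<^esub> = \<zero>\<^bsub>C i\<^esub>"
    using add.inv_one by (simp add: a_inv_def)
  show ?thesis
    using assms hclass_eq_iff[of x i "\<zero>\<^bsub>C i\<^esub>"] a_subset
    by (simp add: zero_homology hclass_def minus_eq r_neg_zero)
qed

text \<open>Vanishing is assumed as a statement about carriers of quotients, but pushing elements
  down needs it as the existence of a preimage for each cycle.\<close>

lemma homology_trivial_iff:
  "carrier (homology C d i) = {\<zero>\<^bsub>homology C d i\<^esub>} \<longleftrightarrow> cycles C d i \<subseteq> boundaries C d i"
proof -
  have "boundaries C d i \<in> carrier (homology C d i)"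
    using vectorspace.axioms(1)[OF homology_vectorspace, THEN Module.module.axioms(2)]
    by (metis zero_homology abelian_group.axioms(1) abelian_monoid.zero_closed)
  then have "carrier (homology C d i) = {\<zero>\<^bsub>homology C d i\<^esub>} \<longleftrightarrow>
      (\<forall>x\<in>cycles C d i. hclass C d i x = \<zero>\<^bsub>homology C d i\<^esub>)"
    by (auto simp: carrier_homology zero_homology)
  also have "\<dots> \<longleftrightarrow> cycles C d i \<subseteq> boundaries C d i"
    using hclass_eq_zero_iff cycles_carrier by blast
  finally show ?thesis .
qed

lemma hclass_self: "x \<in> carrier (C i) \<Longrightarrow> x \<in> hclass C d i x"
  unfolding hclass_def
  by (rule abelian_subgroup.a_rcos_self[OF subspace_abelian_subgroup[OF boundaries_subspace]])

lemma hclass_boundary_add: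
  assumes "b \<in> boundaries C d i" "x \<in> carrier (C i)"
  shows "hclass C d i (b \<oplus>\<^bsub>C i\<^esub> x) = hclass C d i x"
proof -
  interpret abelian_subgroup "boundaries C d i" "C i"
    by (rule subspace_abelian_subgroup) (rule boundaries_subspace)
  have "b \<oplus>\<^bsub>C i\<^esub> x \<in> boundaries C d i +>\<^bsub>C i\<^esub> x" using assms by (auto simp: a_r_coset_def')
  then show ?thesis using assms(2) unfolding hclass_def by (metis a_repr_independence')
qed

text \<open>Here \<open>a\<close> is the negative of \<open>b\<close>, and boundaries form a
  subgroup. The components of \<open>d d = 0\<close> yield relations of exactly this form, and this
  lemma absorbs their sign.\<close>

lemma boundaries_add_eq_zero:
  assumes "a \<in> carrier (C i)" "b \<in> boundaries C d i" "a \<oplus>\<^bsub>C i\<^esub> b = \<zero>\<^bsub>C i\<^esub>"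
  shows "a \<in> boundaries C d i"
proof -
  interpret B: abelian_subgroup "boundaries C d i" "C i"
    by (rule subspace_abelian_subgroup) (rule boundaries_subspace)
  have b: "b \<in> carrier (C i)" using assms(2) B.a_subset by blast
  have "\<ominus>\<^bsub>C i\<^esub> b = a" by (rule B.minus_equality[OF assms(3) b assms(1)])
  then show ?thesis
    using additive_subgroup.a_inv_closed[OF B.is_additive_subgroup assms(2)] by simp
qed

end

text \<open>Two representatives of a class differ by a boundary, which \<open>f\<close> sends to a
  boundary, so the union that defines \<open>induced\<close> is a union of equal sets. Two separate
  degrees \<open>i\<close> and \<open>j\<close> occur because the sub-diagonal components lower the
  degree; those components commute with the diagonal differentials only up to sign, and preservation
  of cycles and boundaries is what they satisfy directly.\<close>

lemma
  assumes C: "chain_complex K C d" and C': "chain_complex K C' d'"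
    and f: "linear_map K (C i) (C' j) f"
    and cycle: "\<And>x. x \<in> cycles C d i \<Longrightarrow> f x \<in> cycles C' d' j"
    and boundary: "\<And>x. x \<in> boundaries C d i \<Longrightarrow> f x \<in> boundaries C' d' j"
  shows induced_hclass: "\<And>x. x \<in> cycles C d i \<Longrightarrow>
      induced C' d' j f (hclass C d i x) = hclass C' d' j (f x)"
    and induced_linear: "linear_map K (homology C d i) (homology C' d' j) (induced C' d' j f)"
proof -
  interpret C: chain_complex K C d by fact
  interpret C': chain_complex K C' d' by fact
  note f_add = linear_map.T_add[OF f] and f_smult = linear_map.T_smult[OF f]
  show induced: "induced C' d' j f (hclass C d i x) = hclass C' d' j (f x)"
    if x: "x \<in> cycles C d i" for x
  proof -
    have "hclass C' d' j (f y) = hclass C' d' j (f x)" if y: "y \<in> hclass C d i x" for y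
    proof -
      from y obtain b where b: "b \<in> boundaries C d i" "y = b \<oplus>\<^bsub>C i\<^esub> x"
        by (auto simp: hclass_def a_r_coset_def')
      then have "b \<in> carrier (C i)"
        using C.boundaries_subset_cycles C.cycles_carrier by blast
      then show ?thesis
        using C.cycles_carrier[OF x] C'.hclass_boundary_add[OF boundary[OF b(1)]]
          linear_map.T_im[OF f] b(2) f_add by metis
    qed
    \<comment> \<open>A union of equal sets is that set only over a nonempty index set;
      \<open>x\<close> itself supplies the index.\<close>
    then show ?thesis
      using C.hclass_self[OF C.cycles_carrier[OF x]] unfolding induced_def
      by (intro SUP_eq_const) blast+
  qed
  have rep: "\<exists>x\<in>cycles C d i. X = hclass C d i x" if "X \<in> carrier (homology C d i)" for X
    using that C.carrier_homology by blast
  show "linear_map K (homology C d i) (homology C' d' j) (induced C' d' j f)"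
  proof (rule linear_mapI)
    fix X assume "X \<in> carrier (homology C d i)"
    then obtain x where x: "x \<in> cycles C d i" "X = hclass C d i x" using rep by blast
    then show "induced C' d' j f X \<in> carrier (homology C' d' j)"
      by (simp add: induced C'.carrier_homology cycle)
    fix c assume c: "c \<in> carrier K"
    show "induced C' d' j f (c \<odot>\<^bsub>homology C d i\<^esub> X) = c \<odot>\<^bsub>homology C' d' j\<^esub> induced C' d' j f X"
      unfolding x(2) C.hclass_smult[OF c x(1), symmetric] induced[OF x(1)]
        induced[OF C.cycles_smult[OF c x(1)]] f_smult[OF c C.cycles_carrier[OF x(1)]]
      by (rule C'.hclass_smult[OF c cycle[OF x(1)]])
  next
    fix X Y assume "X \<in> carrier (homology C d i)" "Y \<in> carrier (homology C d i)"
    then obtain x y where x: "x \<in> cycles C d i" "X = hclass C d i x"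
      and y: "y \<in> cycles C d i" "Y = hclass C d i y" using rep by metis
    show "induced C' d' j f (X \<oplus>\<^bsub>homology C d i\<^esub> Y) =
        induced C' d' j f X \<oplus>\<^bsub>homology C' d' j\<^esub> induced C' d' j f Y"
      unfolding x(2) y(2) C.hclass_add[OF x(1) y(1), symmetric] induced[OF x(1)] induced[OF y(1)]
        induced[OF C.cycles_add[OF x(1) y(1)]]
        f_add[OF C.cycles_carrier[OF x(1)] C.cycles_carrier[OF y(1)]]
      by (rule C'.hclass_add[OF cycle[OF x(1)] cycle[OF y(1)]])
  qed (rule C.homology_vectorspace C'.homology_vectorspace)+
qed

section \<open>Triangular complexes\<close>

locale triangular_complex =
  fixes K :: "('k, 'm) ring_scheme"
    and n :: int
    and C :: "int \<Rightarrow> int \<Rightarrow> ('k, 'a) module"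
    and d :: "int \<Rightarrow> (int \<Rightarrow> 'a) \<Rightarrow> (int \<Rightarrow> 'a)"
  assumes summand: "s \<in> {0..n} \<Longrightarrow> vectorspace K (C s i)"
    and total: "chain_complex K (total_space n C) d"
    and lower: "lower_triangular n C d"
begin

sublocale T: chain_complex K "total_space n C" d
  by (rule total)

abbreviation incl :: "int \<Rightarrow> int \<Rightarrow> 'a \<Rightarrow> int \<Rightarrow> 'a"
  where "incl s i \<equiv> dsum_incl {0..n} (\<lambda>t. C t i) s"

section \<open>Coordinates of the total space\<close>

lemma summand_group: "s \<in> {0..n} \<Longrightarrow> abelian_group (C s i)"
  using summand[of s i] by (simp add: vectorspace_def Module.module_def)

lemma zero_closed: "s \<in> {0..n} \<Longrightarrow> \<zero>\<^bsub>C s i\<^esub> \<in> carrier (C s i)"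
  using summand_group[of s i] by (simp add: abelian_group_def abelian_monoid.zero_closed)

lemma total_group: "abelian_group (total_space n C i)"
  using T.vectorspace[of i] by (simp add: vectorspace_def Module.module_def)

lemma total_closed: "y \<in> carrier (total_space n C i) \<Longrightarrow> s \<in> {0..n} \<Longrightarrow> y s \<in> carrier (C s i)"
  by (auto simp: total_space_def dsum_def)

lemma total_ext:
  assumes "x \<in> carrier (total_space n C i)" "y \<in> carrier (total_space n C i)"
    and "\<And>s. s \<in> {0..n} \<Longrightarrow> x s = y s"
  shows "x = y"
  using assms by (auto simp: total_space_def dsum_def intro: PiE_ext)

lemma zero_total: "s \<in> {0..n} \<Longrightarrow> \<zero>\<^bsub>total_space n C i\<^esub> s = \<zero>\<^bsub>C s i\<^esub>"
  by (simp add: total_space_def dsum_def)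

lemma proj_linear: "s \<in> {0..n} \<Longrightarrow> linear_map K (total_space n C i) (C s i) (\<lambda>y. y s)"
  using T.vectorspace[of i] summand[of s i]
  by (intro linear_mapI) (auto simp: total_space_def dsum_def)

lemma add_total:
  "s \<in> {0..n} \<Longrightarrow> (x \<oplus>\<^bsub>total_space n C i\<^esub> y) s = x s \<oplus>\<^bsub>C s i\<^esub> y s"
  by (simp add: total_space_def dsum_def)

lemma minus_total:
  assumes "s \<in> {0..n}" "x \<in> carrier (total_space n C i)" "y \<in> carrier (total_space n C i)"
  shows "(x \<ominus>\<^bsub>total_space n C i\<^esub> y) s = x s \<ominus>\<^bsub>C s i\<^esub> y s"
  by (rule linear_map.T_minus[OF proj_linear[OF assms(1)] assms(2,3)])

lemma incl_apply: "r \<in> {0..n} \<Longrightarrow> incl s i x r = (if r = s then x else \<zero>\<^bsub>C r i\<^esub>)"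
  by (simp add: dsum_incl_def)

lemma incl_closed:
  "s \<in> {0..n} \<Longrightarrow> x \<in> carrier (C s i) \<Longrightarrow> incl s i x \<in> carrier (total_space n C i)"
  using zero_closed by (auto simp: total_space_def dsum_def dsum_incl_def)

lemma incl_linear:
  assumes s: "s \<in> {0..n}"
  shows "linear_map K (C s i) (total_space n C i) (incl s i)"
proof (rule linear_mapI)
  interpret S: vectorspace K "C s i" by (rule summand) fact
  show "vectorspace K (C s i)" "vectorspace K (total_space n C i)"
    by (rule S.vectorspace_axioms, rule T.vectorspace)
  show "incl s i x \<in> carrier (total_space n C i)" if "x \<in> carrier (C s i)" for x
    by (rule incl_closed[OF s that])
  show "incl s i (x \<oplus>\<^bsub>C s i\<^esub> y) = incl s i x \<oplus>\<^bsub>total_space n C i\<^esub> incl s i y"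
    if "x \<in> carrier (C s i)" "y \<in> carrier (C s i)" for x y
  proof -
    have "\<zero>\<^bsub>C r i\<^esub> \<oplus>\<^bsub>C r i\<^esub> \<zero>\<^bsub>C r i\<^esub> = \<zero>\<^bsub>C r i\<^esub>" if "r \<in> {0..n}" for r
      using abelian_group.axioms(1)[OF summand_group[OF that]] zero_closed[OF that]
      by (simp add: abelian_monoid.l_zero)
    then show ?thesis by (auto simp: total_space_def dsum_def dsum_incl_def fun_eq_iff)
  qed
  show "incl s i (c \<odot>\<^bsub>C s i\<^esub> x) = c \<odot>\<^bsub>total_space n C i\<^esub> incl s i x"
    if "c \<in> carrier K" "x \<in> carrier (C s i)" for c x
  proof -
    have "c \<odot>\<^bsub>C r i\<^esub> \<zero>\<^bsub>C r i\<^esub> = \<zero>\<^bsub>C r i\<^esub>" if "r \<in> {0..n}" for r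
      using vectorspace.axioms(1)[OF summand[OF that]] \<open>c \<in> carrier K\<close>
      by (rule Module.module.smult_r_null)
    then show ?thesis by (auto simp: total_space_def dsum_def dsum_incl_def fun_eq_iff)
  qed
qed

lemma component_linear:
  assumes "r \<in> {0..n}" "s \<in> {0..n}"
  shows "linear_map K (C s i) (C r (i - 1)) (component n C d r s i)"
  unfolding component_def[abs_def]
  by (intro linear_map_compose[OF linear_map_compose[OF incl_linear[OF assms(2)] T.linear]]
      proj_linear assms(1))

text \<open>This is \<open>F\<^sub>p\<close> of the overview in degree \<open>i\<close>. The index
  \<open>p\<close> runs over all integers: the space is zero for \<open>p < 0\<close> and everything
  for \<open>p \<ge> n\<close>. Indices such as \<open>m - 2\<close>, \<open>m + 1\<close> and
  \<open>-1\<close> therefore make sense without distinguishing cases.\<close>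

definition fil :: "int \<Rightarrow> int \<Rightarrow> (int \<Rightarrow> 'a) set"
  where "fil p i = {y \<in> carrier (total_space n C i). \<forall>s\<in>{0..n}. p < s \<longrightarrow> y s = \<zero>\<^bsub>C s i\<^esub>}"

lemma fil_carrier: "y \<in> fil p i \<Longrightarrow> y \<in> carrier (total_space n C i)"
  by (simp add: fil_def)

lemma fil_zero: "y \<in> fil p i \<Longrightarrow> s \<in> {0..n} \<Longrightarrow> p < s \<Longrightarrow> y s = \<zero>\<^bsub>C s i\<^esub>"
  by (simp add: fil_def)

lemma fil_mono: "y \<in> fil p i \<Longrightarrow> p \<le> q \<Longrightarrow> y \<in> fil q i"
  by (simp add: fil_def)

lemma fil_top: "n \<le> p \<Longrightarrow> fil p i = carrier (total_space n C i)"
  by (auto simp: fil_def)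

text \<open>No summand is lost when the descending index lies outside the range of summands. This
  disposes of such indices in the inductions on \<open>p\<close>.\<close>

lemma fil_pred: "p \<notin> {0..n} \<Longrightarrow> fil (p - 1) i = fil p i"
proof -
  assume "p \<notin> {0..n}"
  then have "p - 1 < s \<longleftrightarrow> p < s" if "s \<in> {0..n}" for s
    using that by (cases "p = s") auto
  then show ?thesis unfolding fil_def by (intro Collect_cong) blast
qed

lemma fil_subspace: "VectorSpace.subspace K (fil p i) (total_space n C i)"
proof (rule subspaceI)
  show "vectorspace K (total_space n C i)" by (rule T.vectorspace)
  then interpret V: vectorspace K "total_space n C i" .
  show "fil p i \<subseteq> carrier (total_space n C i)" by (auto simp: fil_def)
  show "\<zero>\<^bsub>total_space n C i\<^esub> \<in> fil p i" by (simp add: fil_def zero_total)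
  show "x \<oplus>\<^bsub>total_space n C i\<^esub> y \<in> fil p i" if "x \<in> fil p i" "y \<in> fil p i" for x y
  proof -
    have "\<zero>\<^bsub>C s i\<^esub> \<oplus>\<^bsub>C s i\<^esub> \<zero>\<^bsub>C s i\<^esub> = \<zero>\<^bsub>C s i\<^esub>" if "s \<in> {0..n}" for s
      using abelian_group.axioms(1)[OF summand_group[OF that]] zero_closed[OF that]
      by (simp add: abelian_monoid.l_zero)
    then show ?thesis
      using that V.M.add.m_closed[of x y] by (simp add: fil_def add_total)
  qed
  show "c \<odot>\<^bsub>total_space n C i\<^esub> x \<in> fil p i" if "c \<in> carrier K" "x \<in> fil p i" for c x
  proof -
    have "c \<odot>\<^bsub>C r i\<^esub> \<zero>\<^bsub>C r i\<^esub> = \<zero>\<^bsub>C r i\<^esub>" if "r \<in> {0..n}" for r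
      using vectorspace.axioms(1)[OF summand[OF that]] \<open>c \<in> carrier K\<close>
      by (rule Module.module.smult_r_null)
    moreover have "(c \<odot>\<^bsub>total_space n C i\<^esub> x) s = c \<odot>\<^bsub>C s i\<^esub> x s" if "s \<in> {0..n}" for s
      using that by (simp add: total_space_def dsum_def)
    ultimately show ?thesis
      using that V.smult_closed[of c x] by (simp add: fil_def)
  qed
qed

lemma fil_add: "x \<in> fil p i \<Longrightarrow> y \<in> fil p i \<Longrightarrow> x \<oplus>\<^bsub>total_space n C i\<^esub> y \<in> fil p i"
  using fil_subspace[of p i] by (simp add: VectorSpace.subspace_def LinearCombinations.submodule_def)

lemma zero_fil: "\<zero>\<^bsub>total_space n C i\<^esub> \<in> fil p i"
  using fil_subspace[of p i] by (simp add: VectorSpace.subspace_def LinearCombinations.submodule_def)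

lemma fil_minus:
  assumes "x \<in> fil p i" "y \<in> fil p i"
  shows "x \<ominus>\<^bsub>total_space n C i\<^esub> y \<in> fil p i"
proof -
  interpret F: abelian_subgroup "fil p i" "total_space n C i"
    by (rule subspace_abelian_subgroup) (rule fil_subspace)
  have "\<ominus>\<^bsub>total_space n C i\<^esub> y \<in> fil p i"
    by (rule additive_subgroup.a_inv_closed[OF F.is_additive_subgroup assms(2)])
  then show ?thesis unfolding a_minus_def by (rule additive_subgroup.a_closed[OF F.is_additive_subgroup assms(1)])
qed

lemma incl_fil:
  assumes "s \<in> {0..n}" "x \<in> carrier (C s i)" "s \<le> p"
  shows "incl s i x \<in> fil p i"
  using assms by (auto simp: fil_def incl_closed incl_apply)

text \<open>One step of the descent. The vanishing is demanded only for \<open>p\<close> in the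
  range, since elsewhere the step is free.\<close>

lemma fil_predI:
  assumes "y \<in> fil p i" "p \<in> {0..n} \<Longrightarrow> y p = \<zero>\<^bsub>C p i\<^esub>"
  shows "y \<in> fil (p - 1) i"
proof -
  have "y s = \<zero>\<^bsub>C s i\<^esub>" if "s \<in> {0..n}" "p - 1 < s" for s
    using assms that by (cases "s = p") (auto simp: fil_def)
  with assms(1) show ?thesis by (simp add: fil_def)
qed

lemma fil_neg: "p < 0 \<Longrightarrow> fil p i = {\<zero>\<^bsub>total_space n C i\<^esub>}"
  using zero_fil by (auto simp: zero_total fil_zero intro!: total_ext[of _ i] fil_carrier)

text \<open>The decomposition
  \<open>F\<^sub>p = F\<^sub>p\<^sub>-\<^sub>1 \<oplus> C\<^sup>p\<close>. It reduces statements
  about the differential on \<open>F\<^sub>p\<close> to a smaller index and to a single summand,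
  where triangularity applies.\<close>

lemma fil_split:
  assumes "y \<in> fil p i" "p \<in> {0..n}"
  obtains u where "u \<in> fil (p - 1) i" "y = u \<oplus>\<^bsub>total_space n C i\<^esub> incl p i (y p)"
proof
  interpret abelian_group "total_space n C i" by (rule total_group)
  let ?z = "incl p i (y p)"
  have z: "?z \<in> fil p i"
    using assms by (intro incl_fil total_closed fil_carrier) auto
  have "y p \<ominus>\<^bsub>C p i\<^esub> y p = \<zero>\<^bsub>C p i\<^esub>"
    using abelian_group.minus_eq_zero_iff[OF summand_group[OF assms(2)]]
      total_closed[OF fil_carrier[OF assms(1)] assms(2)] by blast
  then have "(y \<ominus>\<^bsub>total_space n C i\<^esub> ?z) p = \<zero>\<^bsub>C p i\<^esub>"
    using assms by (simp add: minus_total[OF _ fil_carrier[OF assms(1)] fil_carrier[OF z]] incl_apply)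
  then show "y \<ominus>\<^bsub>total_space n C i\<^esub> ?z \<in> fil (p - 1) i"
    using fil_minus[OF assms(1) z] by (intro fil_predI)
  show "y = (y \<ominus>\<^bsub>total_space n C i\<^esub> ?z) \<oplus>\<^bsub>total_space n C i\<^esub> ?z"
    using fil_carrier[OF assms(1)] fil_carrier[OF z] by (simp add: minus_eq a_assoc l_neg)
qed

section \<open>The differential and the filtration\<close>

lemma d_add:
  assumes "x \<in> carrier (total_space n C i)" "y \<in> carrier (total_space n C i)"
  shows "d i (x \<oplus>\<^bsub>total_space n C i\<^esub> y) = d i x \<oplus>\<^bsub>total_space n C (i - 1)\<^esub> d i y"
  by (rule linear_map.T_add[OF T.linear assms])

lemma d_minus:
  assumes "x \<in> carrier (total_space n C i)" "y \<in> carrier (total_space n C i)"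
  shows "d i (x \<ominus>\<^bsub>total_space n C i\<^esub> y) = d i x \<ominus>\<^bsub>total_space n C (i - 1)\<^esub> d i y"
  by (rule linear_map.T_minus[OF T.linear assms])

lemma d_zero: "d i \<zero>\<^bsub>total_space n C i\<^esub> = \<zero>\<^bsub>total_space n C (i - 1)\<^esub>"
  by (rule linear_map.T0_is_0[OF T.linear])

lemma d_incl_fil:
  assumes "s \<in> {0..n}" "x \<in> carrier (C s i)"
  shows "d i (incl s i x) \<in> fil s (i - 1)"
  using assms lower T.d_closed[OF incl_closed[OF assms]]
  by (auto simp: fil_def lower_triangular_def component_def)

text \<open>Triangularity concerns single summands; splitting them off one at a time extends it to
  sums. The measure \<open>nat (p + 1)\<close> vanishes exactly for \<open>p < 0\<close>, where the
  space is zero.\<close>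

lemma d_fil: "y \<in> fil p i \<Longrightarrow> d i y \<in> fil p (i - 1)"
proof (induction "nat (p + 1)" arbitrary: p y)
  case 0
  then show ?case by (simp add: fil_neg d_zero)
next
  case (Suc k)
  show ?case
  proof (cases "p \<in> {0..n}")
    case True
    obtain u where u: "u \<in> fil (p - 1) i" "y = u \<oplus>\<^bsub>total_space n C i\<^esub> incl p i (y p)"
      using fil_split[OF Suc.prems True] .
    have yp: "y p \<in> carrier (C p i)" by (rule total_closed[OF fil_carrier[OF Suc.prems] True])
    have "d i u \<in> fil p (i - 1)"
      by (rule fil_mono[OF Suc.hyps(1)[OF _ u(1)]]) (use Suc.hyps(2) in simp_all)
    then have "d i u \<oplus>\<^bsub>total_space n C (i - 1)\<^esub> d i (incl p i (y p)) \<in> fil p (i - 1)"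
      by (rule fil_add[OF _ d_incl_fil[OF True yp]])
    then show ?thesis
      by (subst u(2)) (simp only: d_add[OF fil_carrier[OF u(1)] incl_closed[OF True yp]])
  next
    case False
    then have "d i y \<in> fil (p - 1) (i - 1)"
      using Suc by (intro Suc.hyps(1)) (auto simp: fil_pred)
    then show ?thesis by (rule fil_mono) simp
  qed
qed

text \<open>The part of \<open>y\<close> below level \<open>p\<close> stays below level
  \<open>p\<close> under the differential, so only the summand \<open>C p\<close> contributes to
  this component.\<close>

lemma d_diag:
  assumes y: "y \<in> fil p i" and p: "p \<in> {0..n}"
  shows "d i y p = diag n C d p i (y p)"
proof -
  obtain u where u: "u \<in> fil (p - 1) i" "y = u \<oplus>\<^bsub>total_space n C i\<^esub> incl p i (y p)"
    using fil_split[OF y p] .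
  have yp: "y p \<in> carrier (C p i)" by (rule total_closed[OF fil_carrier[OF y] p])
  have closed: "d i (incl p i (y p)) p \<in> carrier (C p (i - 1))"
    by (rule total_closed[OF T.d_closed[OF incl_closed[OF p yp]] p])
  have "d i y p = d i u p \<oplus>\<^bsub>C p (i - 1)\<^esub> d i (incl p i (y p)) p"
    by (subst u(2)) (simp only: d_add[OF fil_carrier[OF u(1)] incl_closed[OF p yp]] add_total[OF p])
  also have "d i u p = \<zero>\<^bsub>C p (i - 1)\<^esub>"
    by (rule fil_zero[OF d_fil[OF u(1)] p]) simp
  finally show ?thesis
    using closed abelian_monoid.l_zero[OF abelian_group.axioms(1)[OF summand_group[OF p]]]
    by (simp add: diag_def component_def)
qed

text \<open>One level further down exactly two summands can contribute: \<open>C p\<close> through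
  the sub-diagonal and \<open>C (p - 1)\<close> through the diagonal. All properties of the
  sub-diagonal components on homology are read off from this identity, applied to elements with
  known boundary.\<close>

lemma d_subdiag:
  assumes y: "y \<in> fil p i" and p: "p \<in> {1..n}"
  shows "d i y (p - 1) =
    subdiag n C d p i (y p) \<oplus>\<^bsub>C (p - 1) (i - 1)\<^esub> diag n C d (p - 1) i (y (p - 1))"
proof -
  have p': "p \<in> {0..n}" "p - 1 \<in> {0..n}" using p by auto
  obtain u where u: "u \<in> fil (p - 1) i" "y = u \<oplus>\<^bsub>total_space n C i\<^esub> incl p i (y p)"
    using fil_split[OF y p'(1)] .
  have yp: "y p \<in> carrier (C p i)" by (rule total_closed[OF fil_carrier[OF y] p'(1)])
  have closed: "d i (incl p i (y p)) (p - 1) \<in> carrier (C (p - 1) (i - 1))"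
    "d i u (p - 1) \<in> carrier (C (p - 1) (i - 1))"
    by (rule total_closed[OF T.d_closed[OF incl_closed[OF p'(1) yp]] p'(2)],
      rule total_closed[OF T.d_closed[OF fil_carrier[OF u(1)]] p'(2)])
  have "y (p - 1) = u (p - 1) \<oplus>\<^bsub>C (p - 1) i\<^esub> \<zero>\<^bsub>C (p - 1) i\<^esub>"
    by (subst u(2)) (simp add: add_total[OF p'(2)] incl_apply[OF p'(2)])
  then have yu: "y (p - 1) = u (p - 1)"
    using abelian_monoid.r_zero[OF abelian_group.axioms(1)[OF summand_group[OF p'(2)]]
        total_closed[OF fil_carrier[OF u(1)] p'(2)]] by simp
  have "d i y (p - 1) = d i u (p - 1) \<oplus>\<^bsub>C (p - 1) (i - 1)\<^esub> d i (incl p i (y p)) (p - 1)"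
    by (subst u(2)) (simp only: d_add[OF fil_carrier[OF u(1)] incl_closed[OF p'(1) yp]] add_total[OF p'(2)])
  also have "\<dots> = d i (incl p i (y p)) (p - 1) \<oplus>\<^bsub>C (p - 1) (i - 1)\<^esub> d i u (p - 1)"
    by (rule abelian_monoid.a_comm[OF abelian_group.axioms(1)[OF summand_group[OF p'(2)]] closed(2,1)])
  also have "d i u (p - 1) = diag n C d (p - 1) i (y (p - 1))"
    unfolding yu by (rule d_diag[OF u(1) p'(2)])
  finally show ?thesis by (simp add: subdiag_def component_def)
qed

text \<open>Diagonal entries of a product of triangular maps multiply, so \<open>d d = 0\<close>
  restricts to the diagonal.\<close>

lemma diag_complex:
  assumes s: "s \<in> {0..n}"
  shows "chain_complex K (C s) (diag n C d s)"
proof (rule chain_complex.intro)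
  fix i
  show "linear_map K (C s i) (C s (i - 1)) (diag n C d s i)"
    unfolding diag_def by (rule component_linear[OF s s])
  show "diag n C d s (i - 1) (diag n C d s i x) = \<zero>\<^bsub>C s (i - 2)\<^esub>" if x: "x \<in> carrier (C s i)" for x
  proof -
    have y: "incl s i x \<in> fil s i" by (rule incl_fil[OF s x]) simp
    have "d (i - 1) (d i (incl s i x)) s = diag n C d s (i - 1) (diag n C d s i x)"
      using d_diag[OF d_fil[OF y] s] d_diag[OF y s] by (simp add: incl_apply[OF s])
    then show ?thesis
      using T.d_d[OF fil_carrier[OF y]] zero_total[OF s] by simp
  qed
  \<comment> \<open>A summand embeds into the total space, so it vanishes in every degree where the
    total space does; this settles both ends of the complex.\<close>
  have trivial: "carrier (C s i) = {\<zero>\<^bsub>C s i\<^esub>}"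
    if "carrier (total_space n C i) = {\<zero>\<^bsub>total_space n C i\<^esub>}" for i
  proof -
    have "x = \<zero>\<^bsub>C s i\<^esub>" if "x \<in> carrier (C s i)" for x
      using incl_closed[OF s that] \<open>carrier (total_space n C i) = _\<close> zero_total[OF s, of i]
        incl_apply[OF s, of i s x] by simp
    then show ?thesis using zero_closed[OF s] by blast
  qed
  show "carrier (C s i) = {\<zero>\<^bsub>C s i\<^esub>}" if "i < 0"
    by (rule trivial[OF T.zero_below[OF that]])
  show "\<exists>N. \<forall>i>N. carrier (C s i) = {\<zero>\<^bsub>C s i\<^esub>}"
    using T.zero_above trivial by blast
qed

text \<open>For \<open>q < p\<close> the boundary of \<open>y\<close> has no component at level
  \<open>p\<close>, so \<open>y p\<close> is a cycle of the diagonal differential. By hypothesis it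
  has a preimage \<open>x\<close>, and subtracting the boundary of \<open>x\<close>, placed in the
  summand \<open>C p\<close>, removes that component. The bound \<open>v \<in> fil p (i + 1)\<close>
  belongs to the claim because \<open>lift_exists\<close> must correct an element without touching
  its top component.\<close>

lemma fil_reduce:
  assumes "y \<in> fil p i" and "d i y \<in> fil q (i - 1)"
    and "\<And>s. s \<in> {0..n} \<Longrightarrow> q < s \<Longrightarrow> s \<le> p \<Longrightarrow>
      cycles (C s) (diag n C d s) i \<subseteq> boundaries (C s) (diag n C d s) i"
  shows "\<exists>v\<in>fil p (i + 1). y \<ominus>\<^bsub>total_space n C i\<^esub> d (i + 1) v \<in> fil q i"
  using assms
proof (induction "nat (p - q)" arbitrary: p y)
  \<comment> \<open>Here \<open>p \<le> q\<close>, so \<open>y\<close> already lies in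
    \<open>fil q i\<close> and the zero correction suffices.\<close>
  case 0
  have "d (i + 1) \<zero>\<^bsub>total_space n C (i + 1)\<^esub> \<in> fil q i"
    using d_zero[of "i + 1"] zero_fil[of i q] by simp
  then have "y \<ominus>\<^bsub>total_space n C i\<^esub> d (i + 1) \<zero>\<^bsub>total_space n C (i + 1)\<^esub> \<in> fil q i"
    using 0 by (intro fil_minus) (auto intro: fil_mono)
  then show ?case using zero_fil by blast
next
  case (Suc k)
  then have "q < p" by simp
  show ?case
  proof (cases "p \<in> {0..n}")
    case p: True
    interpret G: abelian_group "total_space n C i" by (rule total_group)
    interpret G': abelian_group "total_space n C (i - 1)" by (rule total_group)
    have y: "y \<in> carrier (total_space n C i)" by (rule fil_carrier) fact
    have "y p \<in> cycles (C p) (diag n C d p) i"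
      using d_diag[OF Suc.prems(1) p] fil_zero[OF Suc.prems(2) p \<open>q < p\<close>] total_closed[OF y p]
      by (simp add: cycles_def)
    then have "y p \<in> boundaries (C p) (diag n C d p) i"
      using Suc.prems(3)[OF p \<open>q < p\<close>] by blast
    then obtain x where x: "x \<in> carrier (C p (i + 1))" "y p = diag n C d p (i + 1) x"
      by (auto simp: boundaries_def)
    let ?u = "incl p (i + 1) x"
    have u: "?u \<in> fil p (i + 1)" by (rule incl_fil[OF p x(1)]) simp
    have du: "d (i + 1) ?u \<in> fil p i" using d_fil[OF u] by simp
    define y' where "y' = y \<ominus>\<^bsub>total_space n C i\<^esub> d (i + 1) ?u"
    have "y' p = y p \<ominus>\<^bsub>C p i\<^esub> y p"
      using minus_total[OF p y fil_carrier[OF du]] d_diag[OF u p] x(2)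
      by (simp add: y'_def incl_apply[OF p])
    then have "y' p = \<zero>\<^bsub>C p i\<^esub>"
      using abelian_group.minus_eq_zero_iff[OF summand_group[OF p]] total_closed[OF y p] by simp
    then have y': "y' \<in> fil (p - 1) i"
      unfolding y'_def using fil_minus[OF Suc.prems(1) du] by (intro fil_predI)
    have "d i (d (i + 1) ?u) = \<zero>\<^bsub>total_space n C (i - 1)\<^esub>"
      using T.d_d[OF fil_carrier[OF u]] by simp
    \<comment> \<open>Subtracting a boundary leaves \<open>d i y\<close> unchanged, so the
      hypothesis on the boundary survives for the induction.\<close>
    then have "d i y' = d i y \<ominus>\<^bsub>total_space n C (i - 1)\<^esub> \<zero>\<^bsub>total_space n C (i - 1)\<^esub>"
      using d_minus[OF y fil_carrier[OF du]] by (simp add: y'_def)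
    then have "d i y' \<in> fil q (i - 1)"
      using fil_minus[OF Suc.prems(2) zero_fil] by simp
    then have "\<exists>v\<in>fil (p - 1) (i + 1). y' \<ominus>\<^bsub>total_space n C i\<^esub> d (i + 1) v \<in> fil q i"
      using Suc.hyps(2) by (intro Suc.hyps(1)[OF _ y'] Suc.prems(3)) auto
    then obtain v where v: "v \<in> fil (p - 1) (i + 1)"
        "y' \<ominus>\<^bsub>total_space n C i\<^esub> d (i + 1) v \<in> fil q i"
      by blast
    have v': "v \<in> fil p (i + 1)" using v(1) by (rule fil_mono) simp
    have dv: "d (i + 1) v \<in> carrier (total_space n C i)"
      using fil_carrier[OF d_fil[OF v']] by simp
    have "d (i + 1) (?u \<oplus>\<^bsub>total_space n C (i + 1)\<^esub> v) =
        d (i + 1) ?u \<oplus>\<^bsub>total_space n C i\<^esub> d (i + 1) v"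
      using d_add[OF fil_carrier[OF u] fil_carrier[OF v']] by simp
    then have "y \<ominus>\<^bsub>total_space n C i\<^esub> d (i + 1) (?u \<oplus>\<^bsub>total_space n C (i + 1)\<^esub> v) =
        y' \<ominus>\<^bsub>total_space n C i\<^esub> d (i + 1) v"
      using y dv fil_carrier[OF du] by (simp add: y'_def G.minus_eq G.minus_add G.a_assoc)
    then show ?thesis using v(2) fil_add[OF u v'] by (intro bexI) simp_all
  next
    case False
    then have "y \<in> fil (p - 1) i" using Suc.prems(1) by (simp add: fil_pred)
    then have "\<exists>v\<in>fil (p - 1) (i + 1). y \<ominus>\<^bsub>total_space n C i\<^esub> d (i + 1) v \<in> fil q i"
      using Suc.hyps(2) by (intro Suc.hyps(1)[OF _ _ Suc.prems(2)] Suc.prems(3)) auto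
    then show ?thesis using False by (simp add: fil_pred)
  qed
qed

section \<open>Sub-diagonal components on cycles and boundaries\<close>

lemma d_incl_cycle:
  assumes "s \<in> {0..n}" "x \<in> cycles (C s) (diag n C d s) i"
  shows "d i (incl s i x) \<in> fil (s - 1) (i - 1)"
proof (rule fil_predI)
  have x: "x \<in> carrier (C s i)" "diag n C d s i x = \<zero>\<^bsub>C s (i - 1)\<^esub>"
    using assms(2) by (simp_all add: cycles_def)
  show "d i (incl s i x) \<in> fil s (i - 1)" by (rule d_incl_fil[OF assms(1) x(1)])
  show "d i (incl s i x) s = \<zero>\<^bsub>C s (i - 1)\<^esub>" using x(2) by (simp add: diag_def component_def)
qed

lemma d_incl_subdiag: "d i (incl s i x) (s - 1) = subdiag n C d s i x"
  by (simp add: subdiag_def component_def)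

lemma d_incl_diag: "d i (incl s i x) s = diag n C d s i x"
  by (simp add: diag_def component_def)

lemma d_d_total:
  assumes "y \<in> carrier (total_space n C i)" "s \<in> {0..n}"
  shows "d (i - 1) (d i y) s = \<zero>\<^bsub>C s (i - 2)\<^esub>"
  using T.d_d[OF assms(1)] zero_total[OF assms(2)] by simp

lemma subdiag_closed:
  assumes "s \<in> {1..n}" "x \<in> carrier (C s i)"
  shows "subdiag n C d s i x \<in> carrier (C (s - 1) (i - 1))"
  unfolding subdiag_def using assms
  by (intro linear_map.T_im[OF component_linear]) auto

text \<open>For a diagonal cycle \<open>x\<close>, the boundary of its inclusion lies one level
  lower and has top component \<open>subdiag n C d s i x\<close>. Applying the differential again
  gives zero, and on top components it acts as the diagonal.\<close>

lemma subdiag_cycle: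
  assumes s: "s \<in> {1..n}" and x: "x \<in> cycles (C s) (diag n C d s) i"
  shows "subdiag n C d s i x \<in> cycles (C (s - 1)) (diag n C d (s - 1)) (i - 1)"
proof -
  have s': "s \<in> {0..n}" "s - 1 \<in> {0..n}" using s by auto
  have xc: "x \<in> carrier (C s i)" using x by (simp add: cycles_def)
  have "d (i - 1) (d i (incl s i x)) (s - 1) =
      diag n C d (s - 1) (i - 1) (subdiag n C d s i x)"
    using d_diag[OF d_incl_cycle[OF s'(1) x] s'(2)] by (simp add: d_incl_subdiag)
  then show ?thesis
    using d_d_total[OF incl_closed[OF s'(1) xc] s'(2)] subdiag_closed[OF s xc]
    by (simp add: cycles_def)
qed

text \<open>With \<open>x\<close> the diagonal image of \<open>z\<close>, the component of
  \<open>d d z = 0\<close> just below the diagonal says that the sub-diagonal image of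
  \<open>x\<close> and the diagonal image of that of \<open>z\<close> add up to zero.\<close>

lemma subdiag_boundary:
  assumes s: "s \<in> {1..n}" and x: "x \<in> boundaries (C s) (diag n C d s) i"
  shows "subdiag n C d s i x \<in> boundaries (C (s - 1)) (diag n C d (s - 1)) (i - 1)"
proof -
  have s': "s \<in> {0..n}" "s - 1 \<in> {0..n}" using s by auto
  interpret S: chain_complex K "C s" "diag n C d s" by (rule diag_complex[OF s'(1)])
  interpret S': chain_complex K "C (s - 1)" "diag n C d (s - 1)" by (rule diag_complex[OF s'(2)])
  have xc: "x \<in> carrier (C s i)" using x S.boundaries_subset_cycles S.cycles_carrier by blast
  from x obtain z where z: "z \<in> carrier (C s (i + 1))" "x = diag n C d s (i + 1) z"
    by (auto simp: boundaries_def)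
  define y where "y = d (i + 1) (incl s (i + 1) z)"
  have y: "y \<in> fil s i" using d_incl_fil[OF s'(1) z(1)] by (simp add: y_def)
  have "y s = x" by (simp add: y_def z(2) d_incl_diag)
  then have eq: "d i y (s - 1) =
      subdiag n C d s i x \<oplus>\<^bsub>C (s - 1) (i - 1)\<^esub> diag n C d (s - 1) i (y (s - 1))"
    using d_subdiag[OF y s] by simp
  have zero: "d i y (s - 1) = \<zero>\<^bsub>C (s - 1) (i - 1)\<^esub>"
    using d_d_total[OF incl_closed[OF s'(1) z(1)] s'(2)] by (simp add: y_def)
  have sum: "subdiag n C d s i x \<oplus>\<^bsub>C (s - 1) (i - 1)\<^esub> diag n C d (s - 1) i (y (s - 1)) =
      \<zero>\<^bsub>C (s - 1) (i - 1)\<^esub>" by (rule trans[OF eq[symmetric] zero])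
  have bd: "diag n C d (s - 1) i (y (s - 1)) \<in> boundaries (C (s - 1)) (diag n C d (s - 1)) (i - 1)"
    using S'.boundariesI[of "y (s - 1)" "i - 1"] total_closed[OF fil_carrier[OF y] s'(2)] by simp
  show ?thesis by (rule S'.boundaries_add_eq_zero[OF subdiag_closed[OF s xc] bd sum])
qed

text \<open>The component of \<open>d d x = 0\<close> two levels down has a further term, the
  diagonal image of \<open>y (s - 2)\<close>, which is the component of the differential two below
  the diagonal. The composite is therefore zero on homology classes, though in general not on
  elements.\<close>

lemma subdiag_subdiag:
  assumes s: "s \<in> {2..n}" and x: "x \<in> cycles (C s) (diag n C d s) i"
  shows "subdiag n C d (s - 1) (i - 1) (subdiag n C d s i x) \<in>
    boundaries (C (s - 2)) (diag n C d (s - 2)) (i - 2)"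
proof -
  have s': "s \<in> {0..n}" "s \<in> {1..n}" "s - 1 \<in> {1..n}" "s - 2 \<in> {0..n}" using s by auto
  interpret S: chain_complex K "C (s - 2)" "diag n C d (s - 2)" by (rule diag_complex[OF s'(4)])
  have xc: "x \<in> carrier (C s i)" using x by (simp add: cycles_def)
  define y where "y = d i (incl s i x)"
  have y: "y \<in> fil (s - 1) (i - 1)" using d_incl_cycle[OF s'(1) x] by (simp add: y_def)
  have ys: "y (s - 1) = subdiag n C d s i x" by (simp add: y_def d_incl_subdiag)
  have eq: "d (i - 1) y (s - 2) = subdiag n C d (s - 1) (i - 1) (subdiag n C d s i x)
      \<oplus>\<^bsub>C (s - 2) (i - 2)\<^esub> diag n C d (s - 2) (i - 1) (y (s - 2))"
    using d_subdiag[OF y s'(3)] ys by simp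
  have zero: "d (i - 1) y (s - 2) = \<zero>\<^bsub>C (s - 2) (i - 2)\<^esub>"
    using d_d_total[OF incl_closed[OF s'(1) xc] s'(4)] by (simp add: y_def)
  have sum: "subdiag n C d (s - 1) (i - 1) (subdiag n C d s i x) \<oplus>\<^bsub>C (s - 2) (i - 2)\<^esub>
      diag n C d (s - 2) (i - 1) (y (s - 2)) = \<zero>\<^bsub>C (s - 2) (i - 2)\<^esub>" by (rule trans[OF eq[symmetric] zero])
  have bd: "diag n C d (s - 2) (i - 1) (y (s - 2)) \<in>
      boundaries (C (s - 2)) (diag n C d (s - 2)) (i - 2)"
    using S.boundariesI[of "y (s - 2)" "i - 2"] total_closed[OF fil_carrier[OF y] s'(4)] by simp
  have closed: "subdiag n C d (s - 1) (i - 1) (subdiag n C d s i x) \<in> carrier (C (s - 2) (i - 2))"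
    using subdiag_closed[OF s'(3) subdiag_closed[OF s'(2) xc]] by simp
  show ?thesis by (rule S.boundaries_add_eq_zero[OF closed bd sum])
qed

lemma subdiag_linear:
  assumes "s \<in> {1..n}"
  shows "linear_map K (C s i) (C (s - 1) (i - 1)) (subdiag n C d s i)"
  unfolding subdiag_def using assms by (intro component_linear) auto

section \<open>The complex of homology classes\<close>

lemma g_space_eq: "s \<in> {0..n} \<Longrightarrow> g_space n C d s = homology (C s) (diag n C d s) s"
  by (simp add: g_space_def)

lemma g_diff_zero: "s \<notin> {1..n} \<Longrightarrow> g_diff n C d s X = \<zero>\<^bsub>g_space n C d (s - 1)\<^esub>"
  by (auto simp: g_diff_def)

lemma g_diff_hclass:
  assumes s: "s \<in> {1..n}" and x: "x \<in> cycles (C s) (diag n C d s) s"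
  shows "g_diff n C d s (hclass (C s) (diag n C d s) s x) =
    hclass (C (s - 1)) (diag n C d (s - 1)) (s - 1) (subdiag n C d s s x)"
proof -
  have s': "s \<in> {0..n}" "s - 1 \<in> {0..n}" using s by auto
  show ?thesis
    using induced_hclass[OF diag_complex[OF s'(1)] diag_complex[OF s'(2)] subdiag_linear[OF s]
        subdiag_cycle[OF s] subdiag_boundary[OF s] x] s
    by (simp add: g_diff_def)
qed

lemma g_space_vectorspace: "vectorspace K (g_space n C d s)"
proof (cases "s \<in> {0..n}")
  case True
  then show ?thesis using chain_complex.homology_vectorspace[OF diag_complex] by (simp add: g_space_eq)
next
  case False
  have "field K" using T.vectorspace[of 0] by (simp add: vectorspace_def)
  then show ?thesis using False by (auto simp: g_space_def intro: zero_space_vectorspace)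
qed

lemma g_diff_linear: "linear_map K (g_space n C d s) (g_space n C d (s - 1)) (g_diff n C d s)"
proof (cases "s \<in> {1..n}")
  case s: True
  then have s': "s \<in> {0..n}" "s - 1 \<in> {0..n}" by auto
  show ?thesis
    using induced_linear[OF diag_complex[OF s'(1)] diag_complex[OF s'(2)] subdiag_linear[OF s]
        subdiag_cycle[OF s] subdiag_boundary[OF s]] s
    by (simp add: g_diff_def g_space_eq[OF s'(1)] g_space_eq[OF s'(2)])
next
  case False
  then have "g_diff n C d s = (\<lambda>_. \<zero>\<^bsub>g_space n C d (s - 1)\<^esub>)" by (auto simp: g_diff_def)
  then show ?thesis by (simp add: linear_map_zero g_space_vectorspace)
qed

lemma g_complex: "chain_complex K (g_space n C d) (g_diff n C d)"
proof (rule chain_complex.intro)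
  fix s
  show "linear_map K (g_space n C d s) (g_space n C d (s - 1)) (g_diff n C d s)"
    by (rule g_diff_linear)
  show "g_diff n C d (s - 1) (g_diff n C d s X) = \<zero>\<^bsub>g_space n C d (s - 2)\<^esub>"
    if X: "X \<in> carrier (g_space n C d s)" for X
  proof -
    \<comment> \<open>Both maps come from sub-diagonal components only for
      \<open>s \<in> {2..n}\<close>; in the other cases one of them is the zero map by
      definition.\<close>
    consider "s \<in> {2..n}" | "s \<notin> {1..n}" | "s - 1 \<notin> {1..n}" by force
    then show ?thesis
    proof cases
      case 1
      then have s': "s \<in> {0..n}" "s \<in> {1..n}" "s - 1 \<in> {1..n}" "s - 2 \<in> {0..n}" by auto
      interpret S: chain_complex K "C s" "diag n C d s" by (rule diag_complex[OF s'(1)])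
      interpret S': chain_complex K "C (s - 2)" "diag n C d (s - 2)" by (rule diag_complex[OF s'(4)])
      obtain x where x: "x \<in> cycles (C s) (diag n C d s) s" "X = hclass (C s) (diag n C d s) s x"
        using X by (auto simp: g_space_eq[OF s'(1)] S.carrier_homology)
      have "g_diff n C d (s - 1) (g_diff n C d s X) = hclass (C (s - 2)) (diag n C d (s - 2)) (s - 2)
          (subdiag n C d (s - 1) (s - 1) (subdiag n C d s s x))"
        using g_diff_hclass[OF s'(3) subdiag_cycle[OF s'(2) x(1)]]
        by (simp add: x(2) g_diff_hclass[OF s'(2) x(1)])
      also have "\<dots> = \<zero>\<^bsub>g_space n C d (s - 2)\<^esub>"
        unfolding g_space_eq[OF s'(4)]
        using subdiag_subdiag[OF 1 x(1)] S'.boundaries_subset_cycles S'.cycles_carrier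
        by (subst S'.hclass_eq_zero_iff) blast+
      finally show ?thesis .
    next
      case 2
      then show ?thesis
        using linear_map.T0_is_0[OF g_diff_linear[of "s - 1"]] by (simp add: g_diff_zero)
    next
      case 3
      then show ?thesis by (simp add: g_diff_zero)
    qed
  qed
  show "carrier (g_space n C d s) = {\<zero>\<^bsub>g_space n C d s\<^esub>}" if "s < 0"
    using that by (simp add: g_space_def zero_space_def)
  show "\<exists>N. \<forall>s>N. carrier (g_space n C d s) = {\<zero>\<^bsub>g_space n C d s\<^esub>}"
    by (intro exI[of _ n]) (simp add: g_space_def zero_space_def)
qed

sublocale G: chain_complex K "g_space n C d" "g_diff n C d"
  by (rule g_complex)

section \<open>Cycles and boundaries of the complex of homology classes\<close>

lemma T_trivial: "i < 0 \<Longrightarrow> y \<in> carrier (total_space n C i) \<Longrightarrow> y \<in> fil p i"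
  using T.zero_below[of i] zero_fil[of i p] by simp

text \<open>By \<open>d_subdiag\<close>, the boundary of a \<open>y\<close> with top component
  \<open>l\<close> has at level \<open>m - 1\<close> the component \<open>[g] l\<close> up to a
  diagonal boundary, and varying \<open>y (m - 1)\<close> reaches every such boundary. Level
  \<open>m\<close> vanishes because \<open>l\<close> is a cycle, hence the index
  \<open>m - 2\<close>.\<close>

lemma hclass_g_cycle_iff:
  assumes m: "m \<in> {0..n}" and l: "l \<in> cycles (C m) (diag n C d m) m"
  shows "hclass (C m) (diag n C d m) m l \<in> cycles (g_space n C d) (g_diff n C d) m \<longleftrightarrow>
    (\<exists>y\<in>fil m m. y m = l \<and> d m y \<in> fil (m - 2) (m - 1))"
proof -
  interpret M: chain_complex K "C m" "diag n C d m" by (rule diag_complex[OF m])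
  have lc: "l \<in> carrier (C m m)" using l by (rule M.cycles_carrier)
  have li: "incl m m l \<in> fil m m" "incl m m l m = l"
    using incl_fil[OF m lc] incl_apply[OF m] by simp_all
  have "hclass (C m) (diag n C d m) m l \<in> carrier (g_space n C d m)"
    using l by (simp add: g_space_eq[OF m] M.carrier_homology)
  then have cycle_iff: "hclass (C m) (diag n C d m) m l \<in> cycles (g_space n C d) (g_diff n C d) m \<longleftrightarrow>
      g_diff n C d m (hclass (C m) (diag n C d m) m l) = \<zero>\<^bsub>g_space n C d (m - 1)\<^esub>"
    by (simp add: cycles_def)
  show ?thesis
  proof (cases "m = 0")
    \<comment> \<open>The outgoing map is zero here, and degree \<open>m - 1\<close> is negative,
      where the total space is zero; both sides hold.\<close>
    case True
    have "d m (incl m m l) \<in> fil (m - 2) (m - 1)"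
      using True by (intro T_trivial T.d_closed fil_carrier[OF li(1)]) simp
    then have "\<exists>y\<in>fil m m. y m = l \<and> d m y \<in> fil (m - 2) (m - 1)"
      using li by blast
    moreover have "g_diff n C d m (hclass (C m) (diag n C d m) m l) = \<zero>\<^bsub>g_space n C d (m - 1)\<^esub>"
      using True by (intro g_diff_zero) simp
    ultimately show ?thesis using cycle_iff by blast
  next
    case False
    then have m': "m \<in> {1..n}" "m - 1 \<in> {0..n}" using m by auto
    interpret M': chain_complex K "C (m - 1)" "diag n C d (m - 1)" by (rule diag_complex[OF m'(2)])
    interpret A: abelian_group "C m m" by (rule summand_group[OF m])
    have gl: "subdiag n C d m m l \<in> carrier (C (m - 1) (m - 1))" by (rule subdiag_closed[OF m'(1) lc])
    have "g_diff n C d m (hclass (C m) (diag n C d m) m l) = \<zero>\<^bsub>g_space n C d (m - 1)\<^esub> \<longleftrightarrow>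
        subdiag n C d m m l \<in> boundaries (C (m - 1)) (diag n C d (m - 1)) (m - 1)"
      unfolding g_diff_hclass[OF m'(1) l] g_space_eq[OF m'(2)] by (rule M'.hclass_eq_zero_iff[OF gl])
    also have "\<dots> \<longleftrightarrow> (\<exists>y\<in>fil m m. y m = l \<and> d m y \<in> fil (m - 2) (m - 1))"
    proof
      assume "subdiag n C d m m l \<in> boundaries (C (m - 1)) (diag n C d (m - 1)) (m - 1)"
      then obtain z where z: "z \<in> carrier (C (m - 1) m)" "subdiag n C d m m l = diag n C d (m - 1) m z"
        by (auto simp: boundaries_def)
      have zi: "incl (m - 1) m z \<in> fil (m - 1) m" by (rule incl_fil[OF m'(2) z(1)]) simp
      have zi': "incl (m - 1) m z \<in> fil m m" by (rule fil_mono[OF zi]) simp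
      \<comment> \<open>Subtracting \<open>z\<close>, placed in the summand
        \<open>C (m - 1)\<close>, cancels the boundary at level \<open>m - 1\<close> and leaves the
        component at level \<open>m\<close> as it is.\<close>
      define y where "y = incl m m l \<ominus>\<^bsub>total_space n C m\<^esub> incl (m - 1) m z"
      have y: "y \<in> fil m m" unfolding y_def by (rule fil_minus[OF li(1) zi'])
      have "y m = l \<ominus>\<^bsub>C m m\<^esub> \<zero>\<^bsub>C m m\<^esub>"
        unfolding y_def minus_total[OF m fil_carrier[OF li(1)] fil_carrier[OF zi]] li(2)
        using fil_zero[OF zi m] by simp
      then have ym: "y m = l" using A.minus_zero_right[OF lc] by simp
      have dy: "d m y = d m (incl m m l) \<ominus>\<^bsub>total_space n C (m - 1)\<^esub> d m (incl (m - 1) m z)"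
        unfolding y_def by (rule d_minus[OF fil_carrier[OF li(1)] fil_carrier[OF zi]])
      have dl: "d m (incl m m l) \<in> fil (m - 1) (m - 1)" by (rule d_incl_cycle[OF m l])
      have dz: "d m (incl (m - 1) m z) \<in> fil (m - 1) (m - 1)" by (rule d_fil[OF zi])
      have "d m y (m - 1) = subdiag n C d m m l \<ominus>\<^bsub>C (m - 1) (m - 1)\<^esub> subdiag n C d m m l"
        unfolding dy minus_total[OF m'(2) fil_carrier[OF dl] fil_carrier[OF dz]]
          d_incl_subdiag d_incl_diag z(2) ..
      then have "d m y (m - 1) = \<zero>\<^bsub>C (m - 1) (m - 1)\<^esub>"
        using abelian_group.minus_eq_zero_iff[OF summand_group[OF m'(2)] gl gl] by simp
      moreover have "d m y \<in> fil (m - 1) (m - 1)" unfolding dy by (rule fil_minus[OF dl dz])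
      ultimately have "d m y \<in> fil (m - 2) (m - 1)" using fil_predI[of "d m y" "m - 1" "m - 1"] by simp
      then show "\<exists>y\<in>fil m m. y m = l \<and> d m y \<in> fil (m - 2) (m - 1)" using y ym by blast
    next
      assume "\<exists>y\<in>fil m m. y m = l \<and> d m y \<in> fil (m - 2) (m - 1)"
      then obtain y where y: "y \<in> fil m m" "y m = l" "d m y \<in> fil (m - 2) (m - 1)" by blast
      have bd: "diag n C d (m - 1) m (y (m - 1)) \<in>
          boundaries (C (m - 1)) (diag n C d (m - 1)) (m - 1)"
        using M'.boundariesI[of "y (m - 1)" "m - 1"] total_closed[OF fil_carrier[OF y(1)] m'(2)]
        by simp
      have "subdiag n C d m m l \<oplus>\<^bsub>C (m - 1) (m - 1)\<^esub> diag n C d (m - 1) m (y (m - 1)) =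
          \<zero>\<^bsub>C (m - 1) (m - 1)\<^esub>"
        using d_subdiag[OF y(1) m'(1)] fil_zero[OF y(3) m'(2)] y(2) by simp
      then show "subdiag n C d m m l \<in> boundaries (C (m - 1)) (diag n C d (m - 1)) (m - 1)"
        by (rule M'.boundaries_add_eq_zero[OF gl bd])
    qed
    finally show ?thesis using cycle_iff by blast
  qed
qed

text \<open>That the boundary of \<open>w\<close> lies in \<open>fil m m\<close> makes
  \<open>w (m + 1)\<close> a diagonal cycle, and \<open>d_subdiag\<close> splits the top component
  \<open>l\<close> of that boundary into the sub-diagonal image of \<open>w (m + 1)\<close> and the
  diagonal boundary of \<open>w m\<close>. The first term is an image under \<open>[g]\<close>; the
  second accounts for the choice of a representative.\<close>

lemma hclass_g_boundary_iff:
  assumes m: "m \<in> {0..n}" and l: "l \<in> cycles (C m) (diag n C d m) m"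
  shows "hclass (C m) (diag n C d m) m l \<in> boundaries (g_space n C d) (g_diff n C d) m \<longleftrightarrow>
    (\<exists>w\<in>fil (m + 1) (m + 1). d (m + 1) w \<in> fil m m \<and> d (m + 1) w m = l)"
proof -
  interpret M: chain_complex K "C m" "diag n C d m" by (rule diag_complex[OF m])
  interpret A: abelian_group "C m m" by (rule summand_group[OF m])
  have lc: "l \<in> carrier (C m m)" using l by (rule M.cycles_carrier)
  show ?thesis
  proof (cases "m = n")
    \<comment> \<open>At the upper end nothing but zero maps in, so the claim is about diagonal
      boundaries alone; \<open>fil (m + 1)\<close> and \<open>fil m\<close> coincide here.\<close>
    case True
    have "carrier (g_space n C d (m + 1)) \<noteq> {}"
      using True by (simp add: g_space_def zero_space_def)
    then have "boundaries (g_space n C d) (g_diff n C d) m = {\<zero>\<^bsub>g_space n C d m\<^esub>}"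
      using True by (auto simp: boundaries_def g_diff_zero)
    then have "hclass (C m) (diag n C d m) m l \<in> boundaries (g_space n C d) (g_diff n C d) m \<longleftrightarrow>
        l \<in> boundaries (C m) (diag n C d m) m"
      using M.hclass_eq_zero_iff[OF lc] by (simp add: g_space_eq[OF m])
    also have "\<dots> \<longleftrightarrow> (\<exists>w\<in>fil (m + 1) (m + 1). d (m + 1) w \<in> fil m m \<and> d (m + 1) w m = l)"
    proof
      assume "l \<in> boundaries (C m) (diag n C d m) m"
      then obtain z where z: "z \<in> carrier (C m (m + 1))" "l = diag n C d m (m + 1) z"
        by (auto simp: boundaries_def)
      have "incl m (m + 1) z \<in> fil (m + 1) (m + 1)" by (rule incl_fil[OF m z(1)]) simp
      moreover have "d (m + 1) (incl m (m + 1) z) \<in> fil m m" using d_incl_fil[OF m z(1)] by simp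
      moreover have "d (m + 1) (incl m (m + 1) z) m = l" unfolding z(2) by (rule d_incl_diag)
      ultimately show "\<exists>w\<in>fil (m + 1) (m + 1). d (m + 1) w \<in> fil m m \<and> d (m + 1) w m = l" by blast
    next
      assume "\<exists>w\<in>fil (m + 1) (m + 1). d (m + 1) w \<in> fil m m \<and> d (m + 1) w m = l"
      then obtain w where w: "w \<in> fil (m + 1) (m + 1)" "d (m + 1) w m = l" by blast
      have w': "w \<in> fil m (m + 1)" using w(1) True by (simp add: fil_top)
      show "l \<in> boundaries (C m) (diag n C d m) m"
        using M.boundariesI[OF total_closed[OF fil_carrier[OF w'] m]] d_diag[OF w' m] w(2) by simp
    qed
    finally show ?thesis .
  next
    case False
    then have m': "m + 1 \<in> {1..n}" "m + 1 \<in> {0..n}" using m by auto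
    interpret M': chain_complex K "C (m + 1)" "diag n C d (m + 1)" by (rule diag_complex[OF m'(2)])
    have g: "subdiag n C d (m + 1) (m + 1) x \<in> carrier (C m m)"
      if "x \<in> cycles (C (m + 1)) (diag n C d (m + 1)) (m + 1)" for x
      using subdiag_closed[OF m'(1) M'.cycles_carrier[OF that]] by simp
    have "hclass (C m) (diag n C d m) m l \<in> boundaries (g_space n C d) (g_diff n C d) m \<longleftrightarrow>
        (\<exists>x\<in>cycles (C (m + 1)) (diag n C d (m + 1)) (m + 1). hclass (C m) (diag n C d m) m l =
          hclass (C m) (diag n C d m) m (subdiag n C d (m + 1) (m + 1) x))"
      using g_diff_hclass[OF m'(1)]
      by (auto simp: boundaries_def g_space_eq[OF m'(2)] M'.carrier_homology image_iff)
    also have "\<dots> \<longleftrightarrow> (\<exists>x\<in>cycles (C (m + 1)) (diag n C d (m + 1)) (m + 1).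
        l \<ominus>\<^bsub>C m m\<^esub> subdiag n C d (m + 1) (m + 1) x \<in> boundaries (C m) (diag n C d m) m)"
      using M.hclass_eq_iff[OF lc g] by blast
    also have "\<dots> \<longleftrightarrow> (\<exists>w\<in>fil (m + 1) (m + 1). d (m + 1) w \<in> fil m m \<and> d (m + 1) w m = l)"
    proof
      assume "\<exists>x\<in>cycles (C (m + 1)) (diag n C d (m + 1)) (m + 1).
        l \<ominus>\<^bsub>C m m\<^esub> subdiag n C d (m + 1) (m + 1) x \<in> boundaries (C m) (diag n C d m) m"
      then obtain x z where x: "x \<in> cycles (C (m + 1)) (diag n C d (m + 1)) (m + 1)"
        and z: "z \<in> carrier (C m (m + 1))"
          "l \<ominus>\<^bsub>C m m\<^esub> subdiag n C d (m + 1) (m + 1) x = diag n C d m (m + 1) z"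
        by (auto simp: boundaries_def)
      have xi: "incl (m + 1) (m + 1) x \<in> fil (m + 1) (m + 1)"
        by (rule incl_fil[OF m'(2) M'.cycles_carrier[OF x]]) simp
      have zi: "incl m (m + 1) z \<in> fil (m + 1) (m + 1)" by (rule incl_fil[OF m z(1)]) simp
      \<comment> \<open>The summand \<open>x\<close> produces the required class, and
        \<open>z\<close> adjusts its representative to \<open>l\<close> exactly.\<close>
      define w where "w = incl (m + 1) (m + 1) x \<oplus>\<^bsub>total_space n C (m + 1)\<^esub> incl m (m + 1) z"
      have w: "w \<in> fil (m + 1) (m + 1)" unfolding w_def by (rule fil_add[OF xi zi])
      have dw: "d (m + 1) w = d (m + 1) (incl (m + 1) (m + 1) x) \<oplus>\<^bsub>total_space n C m\<^esub>
          d (m + 1) (incl m (m + 1) z)"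
        using d_add[OF fil_carrier[OF xi] fil_carrier[OF zi]] by (simp add: w_def)
      have "d (m + 1) (incl (m + 1) (m + 1) x) \<in> fil m m" using d_incl_cycle[OF m'(2) x] by simp
      moreover have "d (m + 1) (incl m (m + 1) z) \<in> fil m m" using d_incl_fil[OF m z(1)] by simp
      ultimately have dw_fil: "d (m + 1) w \<in> fil m m" unfolding dw by (rule fil_add)
      have "d (m + 1) w m = subdiag n C d (m + 1) (m + 1) x \<oplus>\<^bsub>C m m\<^esub>
          (l \<ominus>\<^bsub>C m m\<^esub> subdiag n C d (m + 1) (m + 1) x)"
        unfolding dw add_total[OF m] z(2) using d_incl_subdiag[of "m + 1" "m + 1" x]
        by (simp add: d_incl_diag)
      then have "d (m + 1) w m = l" using A.add_diff_cancel(1)[OF lc g[OF x]] by simp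
      then show "\<exists>w\<in>fil (m + 1) (m + 1). d (m + 1) w \<in> fil m m \<and> d (m + 1) w m = l"
        using w dw_fil by blast
    next
      assume "\<exists>w\<in>fil (m + 1) (m + 1). d (m + 1) w \<in> fil m m \<and> d (m + 1) w m = l"
      then obtain w where w: "w \<in> fil (m + 1) (m + 1)" "d (m + 1) w \<in> fil m m"
        "d (m + 1) w m = l" by blast
      have wc: "w (m + 1) \<in> carrier (C (m + 1) (m + 1))" "w m \<in> carrier (C m (m + 1))"
        by (rule total_closed[OF fil_carrier[OF w(1)] m'(2)], rule total_closed[OF fil_carrier[OF w(1)] m])
      have "d (m + 1) w (m + 1) = \<zero>\<^bsub>C (m + 1) m\<^esub>" by (rule fil_zero[OF w(2) m'(2)]) simp
      then have x: "w (m + 1) \<in> cycles (C (m + 1)) (diag n C d (m + 1)) (m + 1)"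
        using d_diag[OF w(1) m'(2)] wc(1) by (simp add: cycles_def)
      have bd: "diag n C d m (m + 1) (w m) \<in> boundaries (C m) (diag n C d m) m"
        by (rule M.boundariesI[OF wc(2)])
      then have "diag n C d m (m + 1) (w m) \<in> carrier (C m m)"
        using M.boundaries_subset_cycles M.cycles_carrier by blast
      moreover have "l = subdiag n C d (m + 1) (m + 1) (w (m + 1)) \<oplus>\<^bsub>C m m\<^esub> diag n C d m (m + 1) (w m)"
        using d_subdiag[OF w(1) m'(1)] w(3) by simp
      ultimately have "l \<ominus>\<^bsub>C m m\<^esub> subdiag n C d (m + 1) (m + 1) (w (m + 1)) = diag n C d m (m + 1) (w m)"
        using A.add_diff_cancel(2)[OF _ g[OF x]] by simp
      then show "\<exists>x\<in>cycles (C (m + 1)) (diag n C d (m + 1)) (m + 1).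
        l \<ominus>\<^bsub>C m m\<^esub> subdiag n C d (m + 1) (m + 1) x \<in> boundaries (C m) (diag n C d m) m"
        using x bd by (intro bexI) simp_all
    qed
    finally show ?thesis .
  qed
qed

end

section \<open>The isomorphism\<close>

locale g_vanishing = triangular_complex K n C d
  for K :: "('k, 'm) ring_scheme" and n C d +
  fixes m :: int
  assumes m: "m \<in> {0..n}"
    and low: "\<And>s i. 0 \<le> s \<Longrightarrow> s < i \<Longrightarrow> i \<le> m \<Longrightarrow>
      cycles (C s) (diag n C d s) i \<subseteq> boundaries (C s) (diag n C d s) i"
    and high: "\<And>s i. m \<le> i \<Longrightarrow> i < s \<Longrightarrow> s \<le> n \<Longrightarrow>
      cycles (C s) (diag n C d s) i \<subseteq> boundaries (C s) (diag n C d s) i"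
begin

sublocale M: chain_complex K "C m" "diag n C d m"
  by (rule diag_complex[OF m])

text \<open>The space \<open>Z\<close> of the overview. Its elements are exactly the cycles that the
  theorem admits as completions of their component at level \<open>m\<close>.\<close>

definition fil_cycles :: "(int \<Rightarrow> 'a) set"
  where "fil_cycles = fil m m \<inter> cycles (total_space n C) d m"

definition double_class :: "'a \<Rightarrow> 'a set set"
  where "double_class l = hclass (g_space n C d) (g_diff n C d) m (hclass (C m) (diag n C d m) m l)"

lemma fil_cyclesD:
  assumes "y \<in> fil_cycles"
  shows "y \<in> fil m m" "y \<in> cycles (total_space n C) d m"
    "y \<in> carrier (total_space n C m)" "d m y = \<zero>\<^bsub>total_space n C (m - 1)\<^esub>"
  using assms by (auto simp: fil_cycles_def cycles_def)

lemma fil_cycles_top: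
  assumes "y \<in> fil_cycles"
  shows "y m \<in> cycles (C m) (diag n C d m) m"
  using d_diag[OF fil_cyclesD(1)[OF assms] m] total_closed[OF fil_cyclesD(3)[OF assms] m]
  by (simp add: cycles_def fil_cyclesD(4)[OF assms] zero_total[OF m])

lemma fil_cycles_g_cycle:
  assumes "y \<in> fil_cycles"
  shows "hclass (C m) (diag n C d m) m (y m) \<in> cycles (g_space n C d) (g_diff n C d) m"
  unfolding hclass_g_cycle_iff[OF m fil_cycles_top[OF assms]]
  by (intro bexI[OF _ fil_cyclesD(1)[OF assms]])
    (simp add: fil_cyclesD(4)[OF assms] zero_fil)

lemma fil_cycles_subspace: "VectorSpace.subspace K fil_cycles (total_space n C m)"
  using fil_subspace[of m m] T.cycles_subspace[of m]
  by (auto simp: fil_cycles_def VectorSpace.subspace_def LinearCombinations.submodule_def)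

lemma fil_cycles_vectorspace: "vectorspace K ((total_space n C m)\<lparr>carrier := fil_cycles\<rparr>)"
  by (rule vectorspace.subspace_is_vs[OF T.vectorspace fil_cycles_subspace])

text \<open>Pushing down to index \<open>-1\<close> leaves zero, so the element is a boundary. All
  levels met on the way satisfy \<open>s \<le> p < i \<le> m\<close>, which is the range of
  \<open>low\<close>.\<close>

lemma exact_below:
  assumes "p < i" "i \<le> m" "y \<in> fil p i" "d i y = \<zero>\<^bsub>total_space n C (i - 1)\<^esub>"
  shows "\<exists>v\<in>fil p (i + 1). y = d (i + 1) v"
proof -
  interpret G: abelian_group "total_space n C i" by (rule total_group)
  have "\<exists>v\<in>fil p (i + 1). y \<ominus>\<^bsub>total_space n C i\<^esub> d (i + 1) v \<in> fil (- 1) i"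
    using assms(1,2) by (intro fil_reduce[OF assms(3)] low) (auto simp: assms(4) zero_fil)
  then obtain v where v: "v \<in> fil p (i + 1)"
    "y \<ominus>\<^bsub>total_space n C i\<^esub> d (i + 1) v = \<zero>\<^bsub>total_space n C i\<^esub>"
    by (auto simp: fil_neg)
  have "d (i + 1) v \<in> carrier (total_space n C i)"
    using T.d_closed[OF fil_carrier[OF v(1)]] by simp
  then show ?thesis
    using v G.minus_eq_zero_iff[OF fil_carrier[OF assms(3)]] by blast
qed

text \<open>The description of cycles supplies \<open>x\<close> with boundary in
  \<open>fil (m - 2)\<close>. In degree \<open>m - 1\<close> this is below the position
  \<open>s = i\<close>, so \<open>exact_below\<close> writes that boundary as the boundary of some
  \<open>v\<close> at the same level. Then \<open>x\<close> minus \<open>v\<close> is a cycle, and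
  since \<open>v\<close> has no component at level \<open>m\<close>, the top component is still
  \<open>l\<close>.\<close>

lemma lift_exists:
  assumes l: "l \<in> cycles (C m) (diag n C d m) m"
    and "hclass (C m) (diag n C d m) m l \<in> cycles (g_space n C d) (g_diff n C d) m"
  shows "\<exists>y\<in>fil_cycles. y m = l"
proof -
  interpret A: abelian_group "C m m" by (rule summand_group[OF m])
  obtain x where x: "x \<in> fil m m" "x m = l" "d m x \<in> fil (m - 2) (m - 1)"
    using assms hclass_g_cycle_iff[OF m l] by blast
  have "d (m - 1) (d m x) = \<zero>\<^bsub>total_space n C (m - 1 - 1)\<^esub>"
    using T.d_d[OF fil_carrier[OF x(1)]] by simp
  then have "\<exists>v\<in>fil (m - 2) (m - 1 + 1). d m x = d (m - 1 + 1) v"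
    by (intro exact_below x(3)) simp_all
  then obtain v where v: "v \<in> fil (m - 2) m" "d m x = d m v" by auto
  have v': "v \<in> fil m m" by (rule fil_mono[OF v(1)]) simp
  define y where "y = x \<ominus>\<^bsub>total_space n C m\<^esub> v"
  have y: "y \<in> fil m m" unfolding y_def by (rule fil_minus[OF x(1) v'])
  have dv: "d m v \<in> carrier (total_space n C (m - 1))" by (rule T.d_closed[OF fil_carrier[OF v']])
  have "d m y = \<zero>\<^bsub>total_space n C (m - 1)\<^esub>"
    unfolding y_def d_minus[OF fil_carrier[OF x(1)] fil_carrier[OF v']] v(2)
    using abelian_group.minus_eq_zero_iff[OF total_group dv dv] by simp
  then have "y \<in> fil_cycles" using y fil_carrier[OF y] by (simp add: fil_cycles_def cycles_def)
  moreover have "y m = l \<ominus>\<^bsub>C m m\<^esub> \<zero>\<^bsub>C m m\<^esub>"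
    unfolding y_def minus_total[OF m fil_carrier[OF x(1)] fil_carrier[OF v']] x(2)
    using fil_zero[OF v(1) m] by simp
  then have "y m = l" using A.minus_zero_right[OF M.cycles_carrier[OF l]] by simp
  ultimately show ?thesis by blast
qed

section \<open>The two maps on the filtered cycles\<close>

lemma double_class_linear:
  "linear_map K ((total_space n C m)\<lparr>carrier := fil_cycles\<rparr>)
    (homology (g_space n C d) (g_diff n C d) m) (\<lambda>y. double_class (y m))"
proof (rule linear_mapI)
  show "vectorspace K ((total_space n C m)\<lparr>carrier := fil_cycles\<rparr>)"
    by (rule fil_cycles_vectorspace)
  show "vectorspace K (homology (g_space n C d) (g_diff n C d) m)"
    by (rule G.homology_vectorspace)
next
  fix x assume "x \<in> carrier ((total_space n C m)\<lparr>carrier := fil_cycles\<rparr>)"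
  then have x: "x \<in> fil_cycles" by simp
  note cx = fil_cycles_top[OF x] fil_cycles_g_cycle[OF x]
  show "double_class (x m) \<in> carrier (homology (g_space n C d) (g_diff n C d) m)"
    unfolding double_class_def G.carrier_homology by (rule imageI[OF cx(2)])
  fix c assume c: "c \<in> carrier K"
  have "(c \<odot>\<^bsub>total_space n C m\<^esub> x) m = c \<odot>\<^bsub>C m m\<^esub> x m"
    using m by (simp add: total_space_def dsum_def)
  then show "double_class ((c \<odot>\<^bsub>(total_space n C m)\<lparr>carrier := fil_cycles\<rparr>\<^esub> x) m) =
      c \<odot>\<^bsub>homology (g_space n C d) (g_diff n C d) m\<^esub> double_class (x m)"
    using G.hclass_smult[OF c cx(2)] M.hclass_smult[OF c cx(1)]
    by (simp add: double_class_def g_space_eq[OF m])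
next
  fix x y assume "x \<in> carrier ((total_space n C m)\<lparr>carrier := fil_cycles\<rparr>)"
    "y \<in> carrier ((total_space n C m)\<lparr>carrier := fil_cycles\<rparr>)"
  then have x: "x \<in> fil_cycles" and y: "y \<in> fil_cycles" by simp_all
  note cx = fil_cycles_top[OF x] fil_cycles_g_cycle[OF x]
  note cy = fil_cycles_top[OF y] fil_cycles_g_cycle[OF y]
  show "double_class ((x \<oplus>\<^bsub>(total_space n C m)\<lparr>carrier := fil_cycles\<rparr>\<^esub> y) m) =
      double_class (x m) \<oplus>\<^bsub>homology (g_space n C d) (g_diff n C d) m\<^esub> double_class (y m)"
    using G.hclass_add[OF cx(2) cy(2)] M.hclass_add[OF cx(1) cy(1)] add_total[OF m, of m x y]
    by (simp add: double_class_def g_space_eq[OF m])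
qed

lemma double_class_surj:
  "(\<lambda>y. double_class (y m)) ` fil_cycles = carrier (homology (g_space n C d) (g_diff n C d) m)"
proof (intro equalityI subsetI)
  fix X assume "X \<in> (\<lambda>y. double_class (y m)) ` fil_cycles"
  then show "X \<in> carrier (homology (g_space n C d) (g_diff n C d) m)"
    using fil_cycles_g_cycle by (auto simp: double_class_def G.carrier_homology)
next
  fix X assume "X \<in> carrier (homology (g_space n C d) (g_diff n C d) m)"
  then obtain Y where Y: "Y \<in> cycles (g_space n C d) (g_diff n C d) m"
    "X = hclass (g_space n C d) (g_diff n C d) m Y"
    by (auto simp: G.carrier_homology)
  then obtain l where l: "l \<in> cycles (C m) (diag n C d m) m" "Y = hclass (C m) (diag n C d m) m l"
    using G.cycles_carrier[OF Y(1)] by (auto simp: g_space_eq[OF m] M.carrier_homology)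
  then obtain y where "y \<in> fil_cycles" "y m = l" using Y(1) lift_exists by blast
  then show "X \<in> (\<lambda>y. double_class (y m)) ` fil_cycles"
    using Y(2) l(2) by (auto simp: double_class_def)
qed

lemma total_class_linear:
  "linear_map K ((total_space n C m)\<lparr>carrier := fil_cycles\<rparr>)
    (homology (total_space n C) d m) (hclass (total_space n C) d m)"
  by (rule linear_mapI)
    (simp_all add: fil_cycles_vectorspace T.homology_vectorspace T.carrier_homology
      T.hclass_add T.hclass_smult fil_cyclesD(2))

text \<open>In degree \<open>m\<close> the condition \<open>high\<close> covers every level above
  \<open>m\<close>, so each cycle can be moved into \<open>fil m m\<close> within its homology
  class.\<close>

lemma total_class_surj:
  "hclass (total_space n C) d m ` fil_cycles = carrier (homology (total_space n C) d m)"
proof (intro equalityI subsetI)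
  fix X assume "X \<in> hclass (total_space n C) d m ` fil_cycles"
  then show "X \<in> carrier (homology (total_space n C) d m)"
    using fil_cyclesD(2) by (auto simp: T.carrier_homology)
next
  interpret G: abelian_group "total_space n C m" by (rule total_group)
  fix X assume "X \<in> carrier (homology (total_space n C) d m)"
  then obtain y where y: "y \<in> cycles (total_space n C) d m" "X = hclass (total_space n C) d m y"
    by (auto simp: T.carrier_homology)
  have yc: "y \<in> carrier (total_space n C m)" "d m y = \<zero>\<^bsub>total_space n C (m - 1)\<^esub>"
    using y(1) by (simp_all add: cycles_def)
  have "\<exists>v\<in>fil n (m + 1). y \<ominus>\<^bsub>total_space n C m\<^esub> d (m + 1) v \<in> fil m m"
    using yc by (intro fil_reduce high) (auto simp: fil_top zero_fil)
  then obtain v where v: "v \<in> fil n (m + 1)" "y \<ominus>\<^bsub>total_space n C m\<^esub> d (m + 1) v \<in> fil m m"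
    by blast
  have dv: "d (m + 1) v \<in> carrier (total_space n C m)" "d (m + 1) v \<in> boundaries (total_space n C) d m"
    using T.d_closed[OF fil_carrier[OF v(1)]] T.boundariesI[OF fil_carrier[OF v(1)]] by simp_all
  define y' where "y' = y \<ominus>\<^bsub>total_space n C m\<^esub> d (m + 1) v"
  have y'c: "y' \<in> carrier (total_space n C m)" unfolding y'_def by (rule fil_carrier[OF v(2)])
  have "d m (d (m + 1) v) = \<zero>\<^bsub>total_space n C (m - 1)\<^esub>"
    using T.d_d[OF fil_carrier[OF v(1)]] by simp
  then have "d m y' = \<zero>\<^bsub>total_space n C (m - 1)\<^esub>"
    unfolding y'_def d_minus[OF yc(1) dv(1)] yc(2)
    using abelian_group.minus_zero_right[OF total_group] T.d_closed[OF yc(1)] yc(2) by simp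
  then have "y' \<in> fil_cycles"
    using v(2) y'c by (simp add: fil_cycles_def cycles_def y'_def)
  moreover have "y = d (m + 1) v \<oplus>\<^bsub>total_space n C m\<^esub> y'"
    unfolding y'_def by (rule G.add_diff_cancel(1)[OF yc(1) dv(1), symmetric])
  then have "X = hclass (total_space n C) d m y'"
    using T.hclass_boundary_add[OF dv(2) y'c] y(2) by simp
  ultimately show "X \<in> hclass (total_space n C) d m ` fil_cycles" by blast
qed

text \<open>The left side constrains only the top component of \<open>y\<close>, the right side all
  of \<open>y\<close>. After \<open>hclass_g_boundary_iff\<close> both speak of boundaries:
  \<open>low\<close> in degree \<open>m\<close> takes care of the lower components of
  \<open>y\<close>, and \<open>high\<close> in degree \<open>m + 1\<close> takes care of the upper
  components of a preimage.\<close>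

lemma same_kernel:
  assumes y: "y \<in> fil_cycles"
  shows "double_class (y m) = \<zero>\<^bsub>homology (g_space n C d) (g_diff n C d) m\<^esub> \<longleftrightarrow>
    hclass (total_space n C) d m y = \<zero>\<^bsub>homology (total_space n C) d m\<^esub>"
proof -
  note yD = fil_cyclesD[OF y]
  have ym: "y m \<in> carrier (C m m)" by (rule total_closed[OF yD(3) m])
  have "double_class (y m) = \<zero>\<^bsub>homology (g_space n C d) (g_diff n C d) m\<^esub> \<longleftrightarrow>
      hclass (C m) (diag n C d m) m (y m) \<in> boundaries (g_space n C d) (g_diff n C d) m"
    unfolding double_class_def
    by (rule G.hclass_eq_zero_iff[OF G.cycles_carrier[OF fil_cycles_g_cycle[OF y]]])
  also have "\<dots> \<longleftrightarrow> (\<exists>w\<in>fil (m + 1) (m + 1). d (m + 1) w \<in> fil m m \<and> d (m + 1) w m = y m)"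
    by (rule hclass_g_boundary_iff[OF m fil_cycles_top[OF y]])
  also have "\<dots> \<longleftrightarrow> y \<in> boundaries (total_space n C) d m"
  proof
    assume "\<exists>w\<in>fil (m + 1) (m + 1). d (m + 1) w \<in> fil m m \<and> d (m + 1) w m = y m"
    then obtain w where w: "w \<in> fil (m + 1) (m + 1)" "d (m + 1) w \<in> fil m m" "d (m + 1) w m = y m"
      by blast
    interpret G: abelian_group "total_space n C m" by (rule total_group)
    \<comment> \<open>The top components agree, so the difference is a cycle in
      \<open>fil (m - 1) m\<close>, where cycles are boundaries.\<close>
    define u where "u = y \<ominus>\<^bsub>total_space n C m\<^esub> d (m + 1) w"
    have "u m = y m \<ominus>\<^bsub>C m m\<^esub> y m"
      unfolding u_def minus_total[OF m yD(3) fil_carrier[OF w(2)]] w(3) ..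
    then have "u m = \<zero>\<^bsub>C m m\<^esub>"
      using abelian_group.minus_eq_zero_iff[OF summand_group[OF m] ym ym] by simp
    then have u: "u \<in> fil (m - 1) m"
      unfolding u_def by (intro fil_predI[OF fil_minus[OF yD(1) w(2)]])
    have "d m (d (m + 1) w) = \<zero>\<^bsub>total_space n C (m - 1)\<^esub>"
      using T.d_d[OF fil_carrier[OF w(1)]] by simp
    then have "d m u = \<zero>\<^bsub>total_space n C (m - 1)\<^esub>"
      unfolding u_def d_minus[OF yD(3) fil_carrier[OF w(2)]] yD(4)
      using abelian_group.minus_zero_right[OF total_group] T.d_closed[OF yD(3)] yD(4) by simp
    then have "\<exists>v\<in>fil (m - 1) (m + 1). u = d (m + 1) v"
      by (intro exact_below u) simp_all
    then obtain v where v: "v \<in> fil (m - 1) (m + 1)" "u = d (m + 1) v" by blast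
    have "y = d (m + 1) w \<oplus>\<^bsub>total_space n C m\<^esub> u"
      unfolding u_def by (rule G.add_diff_cancel(1)[OF yD(3) fil_carrier[OF w(2)], symmetric])
    also have "\<dots> = d (m + 1) (w \<oplus>\<^bsub>total_space n C (m + 1)\<^esub> v)"
      using d_add[OF fil_carrier[OF w(1)] fil_carrier[OF v(1)]] v(2) by simp
    finally have "y = d (m + 1) (w \<oplus>\<^bsub>total_space n C (m + 1)\<^esub> v)" .
    moreover have "w \<oplus>\<^bsub>total_space n C (m + 1)\<^esub> v \<in> carrier (total_space n C (m + 1))"
      using fil_carrier[OF fil_add[OF w(1) fil_mono[OF v(1)]]] by simp
    ultimately show "y \<in> boundaries (total_space n C) d m" by (auto intro: T.boundariesI)
  next
    assume "y \<in> boundaries (total_space n C) d m"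
    then obtain w where w: "w \<in> carrier (total_space n C (m + 1))" "y = d (m + 1) w"
      by (auto simp: boundaries_def)
    \<comment> \<open>The boundary of \<open>w\<close> is \<open>y\<close>, which lies in
      \<open>fil m m\<close> and so in \<open>fil (m + 1) m\<close>. Hence the components of
      \<open>w\<close> above level \<open>m + 1\<close> can be removed by subtracting a boundary,
      which does not change \<open>d (m + 1) w\<close>.\<close>
    have "\<exists>v\<in>fil n (m + 1 + 1). w \<ominus>\<^bsub>total_space n C (m + 1)\<^esub> d (m + 1 + 1) v \<in> fil (m + 1) (m + 1)"
    proof (intro fil_reduce high)
      show "w \<in> fil n (m + 1)" using w(1) by (simp add: fil_top)
      show "d (m + 1) w \<in> fil (m + 1) (m + 1 - 1)"
        using fil_mono[OF yD(1), of "m + 1"] w(2) by simp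
    qed auto
    moreover have "m + 1 + 1 = m + 2" by simp
    ultimately obtain v where v: "v \<in> fil n (m + 2)"
      "w \<ominus>\<^bsub>total_space n C (m + 1)\<^esub> d (m + 2) v \<in> fil (m + 1) (m + 1)" by metis
    have dv: "d (m + 2) v \<in> carrier (total_space n C (m + 1))"
      using T.d_closed[OF fil_carrier[OF v(1)]] by (simp add: add.commute)
    have "d (m + 1) (d (m + 2) v) = \<zero>\<^bsub>total_space n C m\<^esub>"
      using T.d_d[OF fil_carrier[OF v(1)]] by (simp add: add.commute)
    then have "d (m + 1) (w \<ominus>\<^bsub>total_space n C (m + 1)\<^esub> d (m + 2) v) =
        y \<ominus>\<^bsub>total_space n C m\<^esub> \<zero>\<^bsub>total_space n C m\<^esub>"
      using d_minus[OF w(1) dv] w(2) by simp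
    then have "d (m + 1) (w \<ominus>\<^bsub>total_space n C (m + 1)\<^esub> d (m + 2) v) = y"
      using abelian_group.minus_zero_right[OF total_group yD(3)] by simp
    then show "\<exists>w\<in>fil (m + 1) (m + 1). d (m + 1) w \<in> fil m m \<and> d (m + 1) w m = y m"
      using v(2) yD(1) by blast
  qed
  also have "\<dots> \<longleftrightarrow> hclass (total_space n C) d m y = \<zero>\<^bsub>homology (total_space n C) d m\<^esub>"
    by (rule T.hclass_eq_zero_iff[OF yD(3), symmetric])
  finally show ?thesis .
qed

lemma homology_isomorphism:
  "\<exists>\<phi>. linear_map K (homology (g_space n C d) (g_diff n C d) m) (homology (total_space n C) d m) \<phi> \<and>
    bij_betw \<phi> (carrier (homology (g_space n C d) (g_diff n C d) m))
      (carrier (homology (total_space n C) d m)) \<and>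
    (\<forall>y\<in>fil_cycles. \<phi> (double_class (y m)) = hclass (total_space n C) d m y)"
  using linear_iso_of_same_kernel[OF double_class_linear total_class_linear]
  by (simp add: double_class_surj total_class_surj same_kernel)

end

theorem theoremI2:
  fixes C :: "int \<Rightarrow> int \<Rightarrow> (int, 'a) module"
    and d :: "int \<Rightarrow> (int \<Rightarrow> 'a) \<Rightarrow> (int \<Rightarrow> 'a)"
    and n :: int
  assumes "0 \<le> n"
    and "\<And>s i. s \<in> {0..n} \<Longrightarrow> vectorspace F2 (C s i)"
    and "chain_complex F2 (total_space n C) d"
    and "lower_triangular n C d"
  shows
    "(\<forall>s\<in>{0..n}. chain_complex F2 (C s) (diag n C d s)) \<and>
     (\<forall>s\<in>{1..n}. \<forall>x\<in>cycles (C s) (diag n C d s) s.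
        subdiag n C d s s x \<in> cycles (C (s - 1)) (diag n C d (s - 1)) (s - 1) \<and>
        g_diff n C d s (hclass (C s) (diag n C d s) s x) =
          hclass (C (s - 1)) (diag n C d (s - 1)) (s - 1) (subdiag n C d s s x)) \<and>
     chain_complex F2 (g_space n C d) (g_diff n C d) \<and>
     (\<forall>m\<in>{0..n}.
        (\<forall>s i. 0 \<le> s \<and> s < i \<and> i \<le> m \<longrightarrow>
           carrier (homology (C s) (diag n C d s) i) = {\<zero>\<^bsub>homology (C s) (diag n C d s) i\<^esub>}) \<and>
        (\<forall>s i. m \<le> i \<and> i < s \<and> s \<le> n \<longrightarrow>
           carrier (homology (C s) (diag n C d s) i) = {\<zero>\<^bsub>homology (C s) (diag n C d s) i\<^esub>}) \<longrightarrow>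
        (let rep = (\<lambda>l. l \<in> cycles (C m) (diag n C d m) m \<and>
                        hclass (C m) (diag n C d m) m l \<in> cycles (g_space n C d) (g_diff n C d) m);
             lift = (\<lambda>l y. y \<in> cycles (total_space n C) d m \<and> y m = l \<and>
                        (\<forall>s\<in>{m<..n}. y s = \<zero>\<^bsub>C s m\<^esub>))
         in (\<forall>l. rep l \<longrightarrow> (\<exists>y. lift l y)) \<and>
            (\<exists>\<phi>. linear_map F2 (homology (g_space n C d) (g_diff n C d) m)
                     (homology (total_space n C) d m) \<phi> \<and>
                 bij_betw \<phi> (carrier (homology (g_space n C d) (g_diff n C d) m))
                     (carrier (homology (total_space n C) d m)) \<and>
                 (\<forall>l y. rep l \<and> lift l y \<longrightarrow>
                    \<phi> (hclass (g_space n C d) (g_diff n C d) m (hclass (C m) (diag n C d m) m l)) =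
                    hclass (total_space n C) d m y))))"
proof -
  interpret triangular_complex F2 n C d
    by (rule triangular_complex.intro) (use assms in auto)
  have 1: "\<forall>s\<in>{0..n}. chain_complex F2 (C s) (diag n C d s)"
    by (intro ballI diag_complex)
  have 2: "\<forall>s\<in>{1..n}. \<forall>x\<in>cycles (C s) (diag n C d s) s.
      subdiag n C d s s x \<in> cycles (C (s - 1)) (diag n C d (s - 1)) (s - 1) \<and>
      g_diff n C d s (hclass (C s) (diag n C d s) s x) =
        hclass (C (s - 1)) (diag n C d (s - 1)) (s - 1) (subdiag n C d s s x)"
    by (intro ballI conjI subdiag_cycle g_diff_hclass)
  have 3: "let rep = (\<lambda>l. l \<in> cycles (C m) (diag n C d m) m \<and>
                hclass (C m) (diag n C d m) m l \<in> cycles (g_space n C d) (g_diff n C d) m);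
         lift = (\<lambda>l y. y \<in> cycles (total_space n C) d m \<and> y m = l \<and>
                (\<forall>s\<in>{m<..n}. y s = \<zero>\<^bsub>C s m\<^esub>))
       in (\<forall>l. rep l \<longrightarrow> (\<exists>y. lift l y)) \<and>
          (\<exists>\<phi>. linear_map F2 (homology (g_space n C d) (g_diff n C d) m)
                 (homology (total_space n C) d m) \<phi> \<and>
             bij_betw \<phi> (carrier (homology (g_space n C d) (g_diff n C d) m))
                 (carrier (homology (total_space n C) d m)) \<and>
             (\<forall>l y. rep l \<and> lift l y \<longrightarrow>
                \<phi> (hclass (g_space n C d) (g_diff n C d) m (hclass (C m) (diag n C d m) m l)) =
                hclass (total_space n C) d m y))"
    if m: "m \<in> {0..n}" and vanish:
      "(\<forall>s i. 0 \<le> s \<and> s < i \<and> i \<le> m \<longrightarrow>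
         carrier (homology (C s) (diag n C d s) i) = {\<zero>\<^bsub>homology (C s) (diag n C d s) i\<^esub>}) \<and>
       (\<forall>s i. m \<le> i \<and> i < s \<and> s \<le> n \<longrightarrow>
         carrier (homology (C s) (diag n C d s) i) = {\<zero>\<^bsub>homology (C s) (diag n C d s) i\<^esub>})"
    for m
  proof -
    \<comment> \<open>The bound on \<open>s\<close> holds throughout both vanishing ranges because
      \<open>m\<close> itself lies in \<open>{0..n}\<close>.\<close>
    have trivial: "cycles (C s) (diag n C d s) i \<subseteq> boundaries (C s) (diag n C d s) i"
      if "s \<in> {0..n}"
        "carrier (homology (C s) (diag n C d s) i) = {\<zero>\<^bsub>homology (C s) (diag n C d s) i\<^esub>}" for s i
      using chain_complex.homology_trivial_iff[OF diag_complex[OF that(1)]] that(2) by blast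
    interpret g_vanishing F2 n C d m
    proof
      show "m \<in> {0..n}" by (rule m)
      show "cycles (C s) (diag n C d s) i \<subseteq> boundaries (C s) (diag n C d s) i"
        if "0 \<le> s" "s < i" "i \<le> m" for s i
        by (rule trivial) (use that m vanish in auto)
      show "cycles (C s) (diag n C d s) i \<subseteq> boundaries (C s) (diag n C d s) i"
        if "m \<le> i" "i < s" "s \<le> n" for s i
        by (rule trivial) (use that m vanish in auto)
    qed
    \<comment> \<open>The completions in the theorem and the elements of \<open>fil_cycles\<close>
      are the same. As the formula for \<open>\<phi>\<close> holds on all of
      \<open>fil_cycles\<close>, it covers every choice of \<open>l\<close> and of its
      completion.\<close>
    have lift_iff: "y \<in> fil_cycles \<longleftrightarrow>
        y \<in> cycles (total_space n C) d m \<and> (\<forall>s\<in>{m<..n}. y s = \<zero>\<^bsub>C s m\<^esub>)" for y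
      using m by (auto simp: fil_cycles_def fil_def cycles_def)
    obtain \<phi> where \<phi>:
      "linear_map F2 (homology (g_space n C d) (g_diff n C d) m) (homology (total_space n C) d m) \<phi>"
      "bij_betw \<phi> (carrier (homology (g_space n C d) (g_diff n C d) m))
        (carrier (homology (total_space n C) d m))"
      "\<And>y. y \<in> fil_cycles \<Longrightarrow> \<phi> (double_class (y m)) = hclass (total_space n C) d m y"
      using homology_isomorphism by metis
    show ?thesis
      unfolding Let_def
    proof (intro conjI allI impI exI[of _ \<phi>] \<phi>(1,2); elim conjE)
      fix l assume "l \<in> cycles (C m) (diag n C d m) m"
        "hclass (C m) (diag n C d m) m l \<in> cycles (g_space n C d) (g_diff n C d) m"
      then show "\<exists>y. y \<in> cycles (total_space n C) d m \<and> y m = l \<and> (\<forall>s\<in>{m<..n}. y s = \<zero>\<^bsub>C s m\<^esub>)"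
        using lift_exists lift_iff by blast
    next
      fix l y assume y: "y \<in> cycles (total_space n C) d m" "\<forall>s\<in>{m<..n}. y s = \<zero>\<^bsub>C s m\<^esub>"
        and l: "y m = l"
      have "y \<in> fil_cycles" using y lift_iff by blast
      then show "\<phi> (hclass (g_space n C d) (g_diff n C d) m (hclass (C m) (diag n C d m) m l)) =
          hclass (total_space n C) d m y"
        unfolding l[symmetric] by (rule \<phi>(3)[unfolded double_class_def])
    qed
  qed
  show ?thesis
    by (rule conjI[OF 1 conjI[OF 2 conjI[OF g_complex]]]) (intro ballI impI, rule 3)
qed

end
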